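(* Let $n\ge 1$ and $\alpha\ge 1$ be integers, and fix one of the $\alpha$ colors, $\beta$. Then the $\alpha$-colored Eulerian polynomial satisfies $$A_n^{\alpha}(x)=\sum_{\tau\in\mathfrak{S}_{n,\beta}^\alpha}x^{d(\tau)}.$$
   Context: For $m\ge1$, $P_m$ denotes the permutohedron: the convex hull in $\mathbb{R}^m$ of all permutations of $(1,2,\dots,m)$, an $(m-1)$-dimensional polytope. Fix a set of $\alpha$ colors and a distinguished color $\beta$. An $\alpha$-colored ordered set partition of $[n]=\{1,\dots,n\}$ is a sequence $(B_1,\dots,B_k)$ of nonempty pairwise disjoint sets with union $[n]$, each block assigned one of the $\alpha$ colors, where the last block $B_k$ always has color $\beta$; its type is the composition $(|B_1|,\dots,|B_k|)$ of $n$. Call it alternating if consecutive blocks have different colors. The $\alpha$-colored permutohedron $P_n^\alpha$ is the polytopal complex which is the disjoint union, over all alternating $\alpha$-colored ordered set partitions $\tau$ of $[n]$, of a copy of $P_{c_1}\times\cdots\times P_{c_k}$, where $(c_1,\dots,c_k)$ is the type of $\tau$; its faces are the nonempty faces of these product polytopes. Let $f_d$ be the number of $d$-dimensional faces of $P_n^\alpha$. The $\alpha$-colored Eulerian polynomial is the $h$-polynomial $A_n^\alpha(t)=(1-t)^{n-1}f(t/(1-t))$ where $f(x)=\sum_{d=0}^{n-1}f_d\,x^{n-1-d}$; equivalently $A_n^\alpha(t)=\sum_{d=0}^{n-1}f_d\,t^{n-1-d}(1-t)^d$. An $\alpha$-colored permutation is a word $w_1^{c_1}\cdots w_n^{c_n}$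 with $w_1\cdots w_n\in\mathfrak{S}_n$ and each $c_i$ one of the $\alpha$ colors; $\mathfrak{S}_{n,\beta}^\alpha$ denotes the set of those with $c_n=\beta$. For such $\tau$, $d(\tau)=|\{i\in[n-1]: w_i>w_{i+1}\text{ or } c_i\neq c_{i+1}\}|$. *)

theory Defs
  imports "HOL-Analysis.Analysis" "HOL-Analysis.Finite_Function_Topology"
    "HOL-Combinatorics.Permutations" "HOL-Computational_Algebra.Polynomial"
begin

text \<open>
  The dimension of the ambient space varies inside the definitions, so \<open>\<real>\<^sup>m\<close> is the space of
  vectors of type \<^typ>\<open>nat \<Rightarrow>\<^sub>0 real\<close> with support in \<open>{1..m}\<close>.  The library's notions
  of convex hull, face and linear dimension apply to it as to every real vector space.
\<close>

definition permutohedron :: "nat \<Rightarrow> (nat \<Rightarrow>\<^sub>0 real) set" where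
  "permutohedron m = convex hull {v. \<exists>p. p permutes {1..m} \<and>
     (\<forall>i. Poly_Mapping.lookup v i = (if i \<in> {1..m} then real (p i) else 0))}"

text \<open>
  A point of \<open>P\<^sub>c\<^sub>1 \<times> \<dots> \<times> P\<^sub>c\<^sub>k\<close> is a tuple of vectors, encoded as a finitely supported
  sequence of vectors (indexed from 0) that vanishes from index \<open>k\<close> on.
\<close>

definition permutohedron_product :: "nat list \<Rightarrow> (nat \<Rightarrow>\<^sub>0 nat \<Rightarrow>\<^sub>0 real) set" where
  "permutohedron_product cs =
     {x. (\<forall>j < length cs. Poly_Mapping.lookup x j \<in> permutohedron (cs ! j)) \<and>
         (\<forall>j \<ge> length cs. Poly_Mapping.lookup x j = 0)}"

text \<open>
  The library's \<^const>\<open>aff_dim\<close> is restricted to types of class \<^class>\<open>euclidean_space\<close>; this is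
  the same number, the dimension of the direction space of the affine hull, for
  finite-dimensional nonempty subsets of an arbitrary real vector space.
\<close>

definition affine_dimension :: "'a::real_vector set \<Rightarrow> nat" where
  "affine_dimension F = dim {x - y | x y. x \<in> F \<and> y \<in> F}"

definition colored_ordered_set_partitions ::
  "nat \<Rightarrow> 'c set \<Rightarrow> 'c \<Rightarrow> (nat set \<times> 'c) list set" where
  "colored_ordered_set_partitions n C \<beta> = {\<tau>.
     (\<forall>j < length \<tau>. fst (\<tau> ! j) \<noteq> {}) \<and>
     (\<forall>i < length \<tau>. \<forall>j < length \<tau>. i \<noteq> j \<longrightarrow> fst (\<tau> ! i) \<inter> fst (\<tau> ! j) = {}) \<and>
     (\<Union>j < length \<tau>. fst (\<tau> ! j)) = {1..n} \<and>
     (\<forall>j < length \<tau>. snd (\<tau> ! j) \<in> C) \<and>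
     \<tau> \<noteq> [] \<and> snd (last \<tau>) = \<beta>}"

definition partition_type :: "(nat set \<times> 'c) list \<Rightarrow> nat list" where
  "partition_type \<tau> = map (\<lambda>(B, c). card B) \<tau>"

definition alternating :: "(nat set \<times> 'c) list \<Rightarrow> bool" where
  "alternating \<tau> \<longleftrightarrow> (\<forall>j. Suc j < length \<tau> \<longrightarrow> snd (\<tau> ! j) \<noteq> snd (\<tau> ! Suc j))"

text \<open>
  The faces of the \<open>\<alpha>\<close>-colored permutohedron; tagging a face with the partition whose
  product polytope it belongs to makes the union disjoint.
\<close>

definition colored_permutohedron_faces ::
  "nat \<Rightarrow> 'c set \<Rightarrow> 'c \<Rightarrow> ((nat set \<times> 'c) list \<times> (nat \<Rightarrow>\<^sub>0 nat \<Rightarrow>\<^sub>0 real) set) set" where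
  "colored_permutohedron_faces n C \<beta> = {(\<tau>, F).
     \<tau> \<in> colored_ordered_set_partitions n C \<beta> \<and> alternating \<tau> \<and>
     F face_of permutohedron_product (partition_type \<tau>) \<and> F \<noteq> {}}"

definition face_number :: "nat \<Rightarrow> 'c set \<Rightarrow> 'c \<Rightarrow> nat \<Rightarrow> nat" where
  "face_number n C \<beta> d =
     card {(\<tau>, F) \<in> colored_permutohedron_faces n C \<beta>. affine_dimension F = d}"

definition f_polynomial :: "nat \<Rightarrow> 'c set \<Rightarrow> 'c \<Rightarrow> real poly" where
  "f_polynomial n C \<beta> = (\<Sum>d = 0..n - 1. monom (real (face_number n C \<beta> d)) (n - 1 - d))"

definition colored_eulerian_polynomial :: "nat \<Rightarrow> 'c set \<Rightarrow> 'c \<Rightarrow> real poly" where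
  "colored_eulerian_polynomial n C \<beta> =
     (\<Sum>d = 0..n - 1. smult (real (face_number n C \<beta> d)) (monom 1 (n - 1 - d) * [:1, -1:] ^ d))"

lemma poly_colored_eulerian_polynomial:
  assumes "t \<noteq> 1"
  shows "poly (colored_eulerian_polynomial n C \<beta>) t =
           (1 - t) ^ (n - 1) * poly (f_polynomial n C \<beta>) (t / (1 - t))"
proof -
  have "(1 - t) ^ (n - 1) * (t / (1 - t)) ^ (n - 1 - d) = t ^ (n - 1 - d) * (1 - t) ^ d"
    if "d \<le> n - 1" for d
  proof -
    have "(1 - t) ^ (n - 1) = (1 - t) ^ (n - 1 - d) * (1 - t) ^ d"
      using that by (metis le_add_diff_inverse2 power_add)
    then show ?thesis
      using assms by (simp add: power_divide)
  qed
  then show ?thesis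
    unfolding colored_eulerian_polynomial_def f_polynomial_def
    by (auto simp: poly_sum poly_monom sum_distrib_left mult.left_commute intro!: sum.cong)
qed

definition colored_permutations :: "nat \<Rightarrow> 'c set \<Rightarrow> 'c \<Rightarrow> (nat \<times> 'c) list set" where
  "colored_permutations n C \<beta> = {w.
     distinct (map fst w) \<and> set (map fst w) = {1..n} \<and> set (map snd w) \<subseteq> C \<and>
     w \<noteq> [] \<and> snd (last w) = \<beta>}"

text \<open>Words are indexed from 0 here, so position \<open>i\<close> stands for position \<open>i + 1 \<in> [n - 1]\<close>.\<close>

definition colored_descents :: "(nat \<times> 'c) list \<Rightarrow> nat" where
  "colored_descents w = card {i. Suc i < length w \<and>
     (fst (w ! i) > fst (w ! Suc i) \<or> snd (w ! i) \<noteq> snd (w ! Suc i))}"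

end

theory Submission
  imports Defs "HOL-Combinatorics.Multiset_Permutations"
begin

text \<open>
  By Rado's theorem the permutohedron is cut out by the inequalities
  \<open>\<Sum>i\<in>S. x\<^sub>i \<ge> |S| (|S| + 1) / 2\<close>, with equality for \<open>S = [m]\<close>.  The sets that are tight at
  a point form a flag from \<open>{}\<close> to \<open>[m]\<close>, every flag arises in this way, and the faces of a polyhedron
  correspond to the sets of inequalities that are tight at one of its points.  Hence the faces of
  a product of permutohedra are tuples of flags, and each inequality lowers the dimension by one.

  Weighting a flag with \<open>k\<close> steps in a set of size \<open>m\<close> by \<open>t\<^sup>k (1 - t)\<^sup>m\<^sup>-\<^sup>k\<close>, removal of
  the top step gives the same recursion for the flags as removal of the last increasing block gives for
  permutations weighted by \<open>t\<close> to the power of one plus the number of descents.  Finally, a colored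
  permutation is the concatenation of its maximal monochromatic runs, which form an alternating
  colored ordered set partition together with a permutation of each of its blocks.  This proves the
  claim with both sides multiplied by \<open>t\<close>.
\<close>

section \<open>Flags and descents\<close>

text \<open>The extra factor \<open>t\<close> serves both sides. If the end of a word counts as a
  descent (the case \<open>[x]\<close> below), every maximal monochromatic run carries a final
  factor \<open>t\<close> of its own, so the weight of a colored word is the product of the weights
  of its runs. For a face of dimension \<open>d\<close> in a product of blocks of total size
  \<open>n\<close>, the number \<open>n - d\<close> is the total number of flag steps, so
  \<open>t ^ (n - d) * (1 - t) ^ d\<close> factors over the blocks as well, which
  \<open>t ^ (n - 1 - d)\<close> would not allow. This reduces the claim to a single block. There,
  flags outnumber permutations in general, so no weight-preserving bijection is sought. The
  recursion for words splits off every nonempty increasing suffix, not only the longest one, and the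
  powers of \<open>1 - t\<close> compensate for the overcount. A suffix of this kind is determined
  by its set of letters, exactly as the top step of a flag is.\<close>

fun descent_weight :: "'b::comm_ring_1 \<Rightarrow> 'a::linorder list \<Rightarrow> 'b" where
  "descent_weight t [] = 1"
| "descent_weight t [x] = t"
| "descent_weight t (x # y # u) = (if x \<le> y then 1 else t) * descent_weight t (y # u)"

text \<open>Let \<open>m\<close> be the length of the longest increasing suffix. Cutting inside it
  leaves the weight \<open>W\<close> of \<open>u\<close> unchanged, and cutting at its start divides
  \<open>W\<close> by \<open>t\<close>. The right-hand side is therefore \<open>W\<close> times a
  geometric sum over \<open>m - 1\<close> cuts plus \<open>W * (1 - t) ^ (m - 1)\<close>, which is
  \<open>W\<close>. The induction avoids naming \<open>m\<close> by prepending letters.\<close>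

lemma descent_weight_last_block:
  "u \<noteq> [] \<Longrightarrow> descent_weight t u = (\<Sum>p<length u. if sorted (drop p u)
      then t * (1 - t) ^ (length u - p - 1) * descent_weight t (take p u) else 0)"
proof (induction t u rule: descent_weight.induct)
  case (3 t x y u)
  define v where "v = y # u"
  define r where "r = (if x \<le> y then 1 else t)"
  define g where "g p = (if sorted (drop p v) then t * (1 - t) ^ (length v - p - 1) else 0)" for p
  have IH: "descent_weight t v = (\<Sum>p<length v. g p * descent_weight t (take p v))"
    using 3 by (auto simp: v_def g_def intro!: sum.cong)
  \<comment> \<open>The empty prefix is exceptional: \<open>x\<close> is then compared with no
    letter and only contributes the factor for the end of the word.\<close>
  have x_take: "descent_weight t (x # take p v) =
      (if p = 0 then t else r * descent_weight t (take p v))" for p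
    by (cases p) (auto simp: v_def r_def)
  have "(\<Sum>p<length (x # v). if sorted (drop p (x # v))
      then t * (1 - t) ^ (length (x # v) - p - 1) * descent_weight t (take p (x # v)) else 0)
    = (if sorted (x # v) then t * (1 - t) ^ length v else 0) +
      (\<Sum>p<length v. g p * descent_weight t (x # take p v))"
    by (subst length_Cons, subst sum.lessThan_Suc_shift)
      (auto simp: g_def intro!: sum.cong)
  also have "(\<Sum>p<length v. g p * descent_weight t (x # take p v)) =
      g 0 * t + (\<Sum>p<length u. g (Suc p) * (r * descent_weight t (take (Suc p) v)))"
    by (simp add: v_def sum.lessThan_Suc_shift r_def del: sum.lessThan_Suc)
  also have "(\<Sum>p<length u. g (Suc p) * (r * descent_weight t (take (Suc p) v))) =
      r * (descent_weight t v - g 0)"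
    by (subst IH) (simp add: v_def sum.lessThan_Suc_shift sum_distrib_left mult_ac
        del: sum.lessThan_Suc)
  \<comment> \<open>For sorted \<open>v\<close> and \<open>x \<le> y\<close>, the cut before
    \<open>x\<close> is new and contributes \<open>(1 - t) * g 0\<close>, exactly what the other
    terms lack. If \<open>x > y\<close>, there is no such cut and the two terms with
    \<open>g 0\<close> cancel.\<close>
  also have "(if sorted (x # v) then t * (1 - t) ^ length v else 0) +
      (g 0 * t + r * (descent_weight t v - g 0)) = r * descent_weight t v"
  proof (cases "sorted v")
    case True
    have "sorted (x # v) \<longleftrightarrow> x \<le> y"
      using True by (auto simp: v_def)
    then show ?thesis
      using True by (auto simp: r_def g_def v_def algebra_simps)
  next
    case False
    then have "\<not> sorted (x # v)" by auto
    with False show ?thesis by (simp add: g_def)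
  qed
  finally show ?case
    unfolding v_def r_def by (simp only: descent_weight.simps)
qed auto

text \<open>Successive differences turn such a chain into an ordered set partition of
  \<open>X\<close> with \<open>card T - 1\<close> blocks. Both ends belong to the chain, so the
  empty set has exactly one flag.\<close>

definition flags :: "'a set \<Rightarrow> 'a set set set" where
  "flags X = {T. T \<subseteq> Pow X \<and> {} \<in> T \<and> X \<in> T \<and> chain_subset T}"

lemma finite_flags: "finite X \<Longrightarrow> finite (flags X)"
  by (rule finite_subset[of _ "Pow (Pow X)"]) (auto simp: flags_def)

lemma flags_finite: "finite X \<Longrightarrow> T \<in> flags X \<Longrightarrow> finite T"
  by (auto simp: flags_def intro: finite_subset)

lemma flags_empty: "flags {} = {{{}}}"
  by (auto simp: flags_def chain_subset_def)

lemma Union_finite_chain_in: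
  "finite T \<Longrightarrow> T \<noteq> {} \<Longrightarrow> chain_subset T \<Longrightarrow> \<Union>T \<in> T"
  by (metis Union_in_chain chain_subset_alt_def)

text \<open>Since \<open>X\<close> is nonempty, \<open>{}\<close> survives the removal of
  \<open>X\<close>. The rest is a nonempty finite chain, whose union is its largest member and
  serves as \<open>Y\<close>.\<close>

lemma flags_remove_top:
  assumes "finite X" "X \<noteq> {}" "T \<in> flags X"
  obtains Y T' where "Y \<subset> X" "T' \<in> flags Y" "T = insert X T'"
proof -
  let ?T = "T - {X}"
  have T: "T \<subseteq> Pow X" "{} \<in> T" "X \<in> T" "chain_subset T"
    using assms(3) by (auto simp: flags_def)
  have fin: "finite ?T"
    using assms(1,3) flags_finite by blast
  have ch: "chain_subset ?T"
    using T(4) by (auto simp: chain_subset_def)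
  have in_T: "\<Union>?T \<in> ?T"
    using fin T(2) assms(2) ch by (intro Union_finite_chain_in) auto
  then have "\<Union>?T \<subset> X"
    using T(1) by auto
  moreover have "?T \<in> flags (\<Union>?T)"
    using in_T T(2) assms(2) ch by (auto simp: flags_def)
  moreover have "T = insert X ?T"
    using T(3) by auto
  ultimately show ?thesis using that by blast
qed

lemma flags_insert_top:
  assumes "Y \<subset> X" "T \<in> flags Y"
  shows "insert X T \<in> flags X" "X \<notin> T"
  using assms by (auto simp: flags_def chain_subset_def)

text \<open>These bounds make the truncated subtractions in \<open>flag_weight\<close>
  exact.\<close>

lemma card_flag:
  assumes "finite X" "T \<in> flags X"
  shows "1 \<le> card T" "card T \<le> Suc (card X)"
proof -
  show "1 \<le> card T"
    using flags_finite[OF assms] assms(2) by (auto simp: flags_def Suc_le_eq card_gt_0_iff)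
  show "card T \<le> Suc (card X)"
    using assms
  proof (induction X arbitrary: T rule: finite_psubset_induct)
    case (psubset X)
    show ?case
    proof (cases "X = {}")
      case True
      then show ?thesis using psubset.prems by (simp add: flags_empty)
    next
      case False
      obtain Y T' where Y: "Y \<subset> X" "T' \<in> flags Y" "T = insert X T'"
        using flags_remove_top[OF psubset.hyps False psubset.prems] .
      then have "card T \<le> Suc (card T')"
        by (simp add: card_insert_le_m1 card_insert_if)
      also have "card T' \<le> Suc (card Y)"
        using psubset.IH Y by blast
      finally show ?thesis
        using psubset_card_mono[OF psubset.hyps Y(1)] by linarith
    qed
  qed
qed

text \<open>For \<open>X = {1..m}\<close> the second exponent is the dimension of the face of the
  permutohedron that belongs to \<open>T\<close>, and the first one is the complement of this
  dimension in \<open>m\<close>.\<close>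

definition flag_weight :: "'b::comm_ring_1 \<Rightarrow> 'a set \<Rightarrow> 'a set set \<Rightarrow> 'b" where
  "flag_weight t X T = t ^ (card T - 1) * (1 - t) ^ (card X + 1 - card T)"

text \<open>Here \<open>Y\<close> is the second largest member of the flag. Dropping
  \<open>X\<close> removes one step and \<open>card X - card Y\<close> elements, which accounts for
  the factor \<open>t\<close> and for the power of \<open>1 - t\<close>.\<close>

lemma sum_flag_weight_rec:
  assumes "finite X" "X \<noteq> {}"
  shows "(\<Sum>T\<in>flags X. flag_weight t X T) =
    (\<Sum>Y | Y \<subset> X. t * (1 - t) ^ (card X - card Y - 1) * (\<Sum>T\<in>flags Y. flag_weight t Y T))"
proof -
  have sub: "finite Y" "finite (flags Y)" if "Y \<subset> X" for Y
    using that assms(1) finite_flags finite_subset by (metis psubset_imp_subset)+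
  have fin: "finite {Y. Y \<subset> X}"
    using assms(1) by (auto intro: finite_subset[of _ "Pow X"])
  have "(\<Sum>Y | Y \<subset> X. t * (1 - t) ^ (card X - card Y - 1) * (\<Sum>T\<in>flags Y. flag_weight t Y T)) =
    (\<Sum>(Y, T)\<in>Sigma {Y. Y \<subset> X} flags. t * (1 - t) ^ (card X - card Y - 1) * flag_weight t Y T)"
    using fin sub by (subst sum.Sigma[symmetric]) (auto simp: sum_distrib_left)
  also have "\<dots> = (\<Sum>T\<in>flags X. flag_weight t X T)"
  proof (rule sum.reindex_bij_witness[where j = "\<lambda>(Y, T). insert X T"
        and i = "\<lambda>T. (\<Union>(T - {X}), T - {X})"])
    fix p assume "p \<in> Sigma {Y. Y \<subset> X} flags"
    then obtain Y T where p: "p = (Y, T)" "Y \<subset> X" "T \<in> flags Y" by auto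
    have X: "insert X T \<in> flags X" "X \<notin> T"
      using flags_insert_top[OF p(2,3)] by auto
    have Y: "\<Union>T = Y" using p by (auto simp: flags_def)
    show "(case p of (Y, T) \<Rightarrow> insert X T) \<in> flags X"
      using X p by simp
    show "(\<Union>((case p of (Y, T) \<Rightarrow> insert X T) - {X}), (case p of (Y, T) \<Rightarrow> insert X T) - {X}) = p"
      using X Y p by simp
    have "finite T" using sub(1) p flags_finite by blast
    have c: "card Y < card X" "1 \<le> card T" "card T \<le> Suc (card Y)"
      using p sub card_flag[of Y T] psubset_card_mono[OF assms(1)] by auto
    have "(1 - t) ^ (card X - card Y - 1) * (1 - t) ^ (card Y + 1 - card T) = (1 - t) ^ (card X - card T)"
      using c by (subst power_add[symmetric]) (auto intro: arg_cong)
    moreover have "t * t ^ (card T - 1) = t ^ card T"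
      using c by (metis Suc_pred' Suc_le_eq One_nat_def power_Suc)
    moreover have "t * (1 - t) ^ (card X - card Y - 1) * (t ^ (card T - 1) * (1 - t) ^ (card Y + 1 - card T)) =
        (t * t ^ (card T - 1)) * ((1 - t) ^ (card X - card Y - 1) * (1 - t) ^ (card Y + 1 - card T))"
      by (simp only: mult_ac)
    ultimately have "t * (1 - t) ^ (card X - card Y - 1) * (t ^ (card T - 1) * (1 - t) ^ (card Y + 1 - card T)) =
        t ^ card T * (1 - t) ^ (card X - card T)"
      by simp
    then show "flag_weight t X (case p of (Y, T) \<Rightarrow> insert X T) =
        (case p of (Y, T) \<Rightarrow> t * (1 - t) ^ (card X - card Y - 1) * flag_weight t Y T)"
      using p X(2) \<open>finite T\<close> by (simp add: flag_weight_def)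
  next
    fix T assume T: "T \<in> flags X"
    obtain Y T' where Y: "Y \<subset> X" "T' \<in> flags Y" "T = insert X T'"
      using flags_remove_top[OF assms T] .
    have "X \<notin> T'" using flags_insert_top(2)[OF Y(1,2)] .
    moreover have "\<Union>T' = Y" using Y by (auto simp: flags_def)
    ultimately show "(\<Union>(T - {X}), T - {X}) \<in> Sigma {Y. Y \<subset> X} flags"
      using Y by simp
    show "(case (\<Union>(T - {X}), T - {X}) of (Y, T) \<Rightarrow> insert X T) = T"
      using Y by auto
  qed
  finally show ?thesis by simp
qed

text \<open>Pairs of a permutation and a cut before an increasing suffix correspond to pairs of a
  proper subset \<open>Y\<close> and a permutation of it: the suffix is recovered by sorting
  \<open>X - Y\<close>.\<close>

lemma sum_descent_weight_rec:
  assumes "finite X" "X \<noteq> {}"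
  shows "(\<Sum>u\<in>permutations_of_set X. descent_weight t u) =
    (\<Sum>Y | Y \<subset> X. t * (1 - t) ^ (card X - card Y - 1) *
      (\<Sum>u\<in>permutations_of_set Y. descent_weight t u))"
proof -
  let ?A = "Sigma {Y. Y \<subset> X} permutations_of_set"
  let ?B = "Sigma (permutations_of_set X) (\<lambda>u. {p. p < length u \<and> sorted (drop p u)})"
  have fin: "finite {Y. Y \<subset> X}"
    using assms(1) by (auto intro: finite_subset[of _ "Pow X"])
  have "(\<Sum>u\<in>permutations_of_set X. descent_weight t u) =
      (\<Sum>u\<in>permutations_of_set X. \<Sum>p | p < length u \<and> sorted (drop p u).
        t * (1 - t) ^ (card X - p - 1) * descent_weight t (take p u))"
  proof (rule sum.cong)
    fix u assume u: "u \<in> permutations_of_set X"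
    then have "u \<noteq> []" "length u = card X"
      using assms by (auto dest: permutations_of_setD simp: length_finite_permutations_of_set)
    then show "descent_weight t u = (\<Sum>p | p < length u \<and> sorted (drop p u).
        t * (1 - t) ^ (card X - p - 1) * descent_weight t (take p u))"
      by (subst descent_weight_last_block)
        (auto simp: sum.inter_filter[symmetric] lessThan_def intro!: sum.cong)
  qed simp
  also have "\<dots> = (\<Sum>(u, p)\<in>?B. t * (1 - t) ^ (card X - p - 1) * descent_weight t (take p u))"
    using assms(1) by (subst sum.Sigma) auto
  also have "\<dots> = (\<Sum>(Y, v)\<in>?A. t * (1 - t) ^ (card X - card Y - 1) * descent_weight t v)"
  proof (rule sum.reindex_bij_witness[where i = "\<lambda>(Y, v). (v @ sorted_list_of_set (X - Y), card Y)"
        and j = "\<lambda>(u, p). (set (take p u), take p u)"])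
    fix q assume "q \<in> ?B"
    then obtain u p where q: "q = (u, p)" "set u = X" "distinct u" "p < length u" "sorted (drop p u)"
      by (auto dest: permutations_of_setD)
    have dist: "distinct (take p u @ drop p u)" using q by simp
    then have dj: "set (take p u) \<inter> set (drop p u) = {}" by (simp only: distinct_append)
    have "set (take p u) \<union> set (drop p u) = X"
      using q by (metis append_take_drop_id set_append)
    then have diff: "X - set (take p u) = set (drop p u)" using dj by blast
    have "sorted_list_of_set (set (drop p u)) = drop p u"
      using q by (simp add: sorted_list_of_set.idem_if_sorted_distinct)
    moreover have c: "card (set (take p u)) = p"
      using q by (simp add: distinct_card)
    ultimately show "(case case q of (u, p) \<Rightarrow> (set (take p u), take p u) of
        (Y, v) \<Rightarrow> (v @ sorted_list_of_set (X - Y), card Y)) = q"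
      using q diff by simp
    have "set (drop p u) \<noteq> {}" using q by simp
    then have "set (take p u) \<subset> X" using dj diff q
      by (metis Diff_eq_empty_iff set_take_subset psubsetI subset_refl)
    then show "(case q of (u, p) \<Rightarrow> (set (take p u), take p u)) \<in> ?A"
      using q by auto
    show "(case case q of (u, p) \<Rightarrow> (set (take p u), take p u) of
        (Y, v) \<Rightarrow> t * (1 - t) ^ (card X - card Y - 1) * descent_weight t v) =
        (case q of (u, p) \<Rightarrow> t * (1 - t) ^ (card X - p - 1) * descent_weight t (take p u))"
      using q c by simp
  next
    fix q assume "q \<in> ?A"
    then obtain Y v where q: "q = (Y, v)" "Y \<subset> X" "set v = Y" "distinct v"
      by (auto dest: permutations_of_setD)
    have l: "length v = card Y" using q by (metis distinct_card)
    have fin: "finite (X - Y)" using assms(1) by simp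
    have ne: "sorted_list_of_set (X - Y) \<noteq> []" using q fin by auto
    have "distinct (v @ sorted_list_of_set (X - Y))" "set (v @ sorted_list_of_set (X - Y)) = X"
      using q fin by auto
    moreover have "card Y < length (v @ sorted_list_of_set (X - Y))"
      using ne length_greater_0_conv[of "sorted_list_of_set (X - Y)"] unfolding length_append l
      by linarith
    moreover have "sorted (drop (card Y) (v @ sorted_list_of_set (X - Y)))"
      using l by simp
    ultimately show "(case q of (Y, v) \<Rightarrow> (v @ sorted_list_of_set (X - Y), card Y)) \<in> ?B"
      using q by (simp add: permutations_of_set_def)
    show "(case case q of (Y, v) \<Rightarrow> (v @ sorted_list_of_set (X - Y), card Y) of
        (u, p) \<Rightarrow> (set (take p u), take p u)) = q"
      using q l by simp
  qed
  also have "\<dots> = (\<Sum>Y | Y \<subset> X. t * (1 - t) ^ (card X - card Y - 1) *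
      (\<Sum>u\<in>permutations_of_set Y. descent_weight t u))"
    using fin by (subst sum.Sigma[symmetric]) (auto simp: sum_distrib_left)
  finally show ?thesis .
qed

lemma sum_flag_weight_eq_descent_weight:
  "finite X \<Longrightarrow> (\<Sum>T\<in>flags X. flag_weight t X T) = (\<Sum>u\<in>permutations_of_set X. descent_weight t u)"
proof (induction X rule: finite_psubset_induct)
  case (psubset X)
  show ?case
  proof (cases "X = {}")
    case True
    then show ?thesis by (simp add: flags_empty flag_weight_def)
  next
    case False
    then show ?thesis using psubset
      by (simp add: sum_flag_weight_rec sum_descent_weight_rec)
  qed
qed

text \<open>Bridges the faces, whose flags live in \<open>{1..c}\<close>, and the blocks of a
  partition, which are arbitrary sets of size \<open>c\<close>. The recursion depends on
  cardinalities only, so it is enough to transport proper subsets along a bijection, and no flag has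
  to be transported.\<close>

lemma sum_flag_weight_card_cong:
  assumes "finite X" "finite X'" "card X = card X'"
  shows "(\<Sum>T\<in>flags X. flag_weight t X T) = (\<Sum>T\<in>flags X'. flag_weight t X' T)"
  using assms
proof (induction X arbitrary: X' rule: finite_psubset_induct)
  case (psubset X)
  show ?case
  proof (cases "X = {}")
    case True
    then show ?thesis using psubset by (simp add: flags_empty flag_weight_def)
  next
    case False
    then have False': "X' \<noteq> {}" using psubset by auto
    obtain h where h: "bij_betw h X X'"
      using psubset finite_same_card_bij by blast
    have hX: "h ` X = X'" "inj_on h X" using h by (auto simp: bij_betw_def)
    have "image h ` {Y. Y \<subset> X} = {Y. Y \<subset> X'}"
    proof (intro equalityI subsetI)
      fix Z assume "Z \<in> image h ` {Y. Y \<subset> X}"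
      then obtain Y where "Y \<subset> X" "Z = h ` Y" by auto
      then show "Z \<in> {Y. Y \<subset> X'}"
        using hX(1) inj_on_image_eq_iff[OF hX(2), of Y X] image_mono[of Y X h] by auto
    next
      fix Z assume "Z \<in> {Y. Y \<subset> X'}"
      then obtain Y where "Y \<subseteq> X" "Z = h ` Y"
        using hX(1) subset_imageE[of Z h X] by auto
      then show "Z \<in> image h ` {Y. Y \<subset> X}"
        using \<open>Z \<in> {Y. Y \<subset> X'}\<close> hX(1) by (cases "Y = X") auto
    qed
    then have bij: "bij_betw (image h) {Y. Y \<subset> X} {Y. Y \<subset> X'}"
      using bij_betw_imp_inj_on[OF bij_betw_Pow[OF h]]
      by (auto simp: bij_betw_def intro: inj_on_subset)
    have "(\<Sum>T\<in>flags X'. flag_weight t X' T) = (\<Sum>Y | Y \<subset> X'. t * (1 - t) ^ (card X' - card Y - 1)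
        * (\<Sum>T\<in>flags Y. flag_weight t Y T))"
      using psubset.prems False' by (intro sum_flag_weight_rec) auto
    also have "\<dots> = (\<Sum>Y | Y \<subset> X. t * (1 - t) ^ (card X' - card (h ` Y) - 1)
        * (\<Sum>T\<in>flags (h ` Y). flag_weight t (h ` Y) T))"
      using sum.reindex_bij_betw[OF bij, where g = "\<lambda>Y. t * (1 - t) ^ (card X' - card Y - 1)
        * (\<Sum>T\<in>flags Y. flag_weight t Y T)"] by simp
    also have "\<dots> = (\<Sum>Y | Y \<subset> X. t * (1 - t) ^ (card X - card Y - 1)
        * (\<Sum>T\<in>flags Y. flag_weight t Y T))"
    proof (rule sum.cong)
      fix Y assume "Y \<in> {Y. Y \<subset> X}"
      then have Y: "Y \<subset> X" by simp
      then have "card (h ` Y) = card Y" "finite (h ` Y)"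
        using hX psubset.hyps by (auto intro!: card_image intro: inj_on_subset finite_subset)
      then show "t * (1 - t) ^ (card X' - card (h ` Y) - 1)
        * (\<Sum>T\<in>flags (h ` Y). flag_weight t (h ` Y) T) = t * (1 - t) ^ (card X - card Y - 1)
        * (\<Sum>T\<in>flags Y. flag_weight t Y T)"
        using psubset.IH[OF Y, of "h ` Y"] psubset.prems by simp
    qed simp
    also have "\<dots> = (\<Sum>T\<in>flags X. flag_weight t X T)"
      by (rule sum_flag_weight_rec[OF psubset.hyps False, symmetric])
    finally show ?thesis by simp
  qed
qed

section \<open>Monochromatic runs\<close>

fun colored_weight :: "'b::comm_ring_1 \<Rightarrow> ('a::linorder \<times> 'c) list \<Rightarrow> 'b" where
  "colored_weight t [] = 1"
| "colored_weight t [p] = t"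
| "colored_weight t (p # q # w) =
     (if fst p > fst q \<or> snd p \<noteq> snd q then t else 1) * colored_weight t (q # w)"

lemma colored_descents_Cons_Cons:
  "colored_descents (p # q # w) =
     (if fst p > fst q \<or> snd p \<noteq> snd q then 1 else 0) + colored_descents (q # w)"
proof -
  let ?D = "\<lambda>w. {i. Suc i < length w \<and> (fst (w ! i) > fst (w ! Suc i) \<or> snd (w ! i) \<noteq> snd (w ! Suc i))}"
  have fin: "finite (?D v)" for v
    by (rule finite_subset[of _ "{..<length v}"]) auto
  have "?D (p # q # w) = (if fst p > fst q \<or> snd p \<noteq> snd q then {0} else {}) \<union> Suc ` ?D (q # w)"
    by (rule set_eqI, case_tac x) auto
  then show ?thesis
    unfolding colored_descents_def using fin[of "q # w"] by (simp add: card_image card_insert_if)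
qed

lemma colored_weight_eq_power:
  "w \<noteq> [] \<Longrightarrow> colored_weight t w = t ^ Suc (colored_descents w)"
proof (induction t w rule: colored_weight.induct)
  case (2 t p)
  then show ?case by (simp add: colored_descents_def)
qed (auto simp: colored_descents_Cons_Cons)

text \<open>The factor \<open>t\<close> for the end of \<open>u\<close> reappears in the
  concatenation as the color change at the boundary, or as the end of the whole word if
  \<open>w\<close> is empty.\<close>

lemma colored_weight_append:
  assumes "w \<noteq> [] \<Longrightarrow> snd (hd w) \<noteq> c"
  shows "colored_weight t (map (\<lambda>x. (x, c)) u @ w) = descent_weight t u * colored_weight t w"
proof (induction t u rule: descent_weight.induct)
  case (2 t x)
  then show ?case using assms by (cases w) auto
next
  case (3 t x y u)
  then show ?case by (auto simp: not_less[symmetric])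
qed simp

text \<open>A run keeps its letters and its color but forgets their order. The order within each run
  is what remains to be summed over in a fibre of \<open>runs\<close>.\<close>

fun runs :: "('a \<times> 'c) list \<Rightarrow> ('a set \<times> 'c) list" where
  "runs [] = []"
| "runs ((x, c) # w) = (case runs w of [] \<Rightarrow> [({x}, c)]
     | (B, c') # \<tau> \<Rightarrow> if c = c' then (insert x B, c) # \<tau> else ({x}, c) # (B, c') # \<tau>)"

lemma alternating_Nil [simp]: "alternating []"
  by (simp add: alternating_def)

lemma alternating_Cons:
  "alternating (p # \<tau>) \<longleftrightarrow> (\<tau> \<noteq> [] \<longrightarrow> snd p \<noteq> snd (hd \<tau>)) \<and> alternating \<tau>"
  unfolding alternating_def
  by (cases \<tau>) (auto simp: nth_Cons split: nat.splits)

lemma runs_eq_Nil_iff [simp]: "runs w = [] \<longleftrightarrow> w = []"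
  by (cases w rule: runs.cases) (auto split: list.splits)

lemma snd_hd_runs: "w \<noteq> [] \<Longrightarrow> snd (hd (runs w)) = snd (hd w)"
  by (cases w rule: runs.cases) (auto split: list.splits)

lemma snd_last_runs: "w \<noteq> [] \<Longrightarrow> snd (last (runs w)) = snd (last w)"
  by (induction w rule: runs.induct) (auto split: list.splits if_splits)

lemma snd_set_runs: "snd ` set (runs w) = snd ` set w"
proof (induction w rule: runs.induct)
  case (2 x c w)
  from 2[symmetric] show ?case by (auto split: list.split)
qed simp

lemma Union_runs: "\<Union>(fst ` set (runs w)) = fst ` set w"
proof (induction w rule: runs.induct)
  case (2 x c w)
  from 2[symmetric] show ?case by (auto split: list.split)
qed simp

lemma runs_nonempty: "p \<in> set (runs w) \<Longrightarrow> fst p \<noteq> {}"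
  by (induction w arbitrary: p rule: runs.induct) (auto split: list.splits if_splits)

lemma alternating_runs: "alternating (runs w)"
  by (induction w rule: runs.induct) (auto simp: alternating_Cons split: list.splits if_splits)

lemma disjoint_runs:
  "distinct (map fst w) \<Longrightarrow> sorted_wrt (\<lambda>p q. fst p \<inter> fst q = {}) (runs w)"
proof (induction w rule: runs.induct)
  case (2 x c w)
  have "x \<notin> \<Union>(fst ` set (runs w))"
    using 2 by (auto simp: Union_runs)
  then show ?case using 2 by (cases "runs w") (auto simp: Int_insert_left)
qed simp

lemma runs_append:
  assumes "u \<noteq> []" "w \<noteq> [] \<Longrightarrow> snd (hd w) \<noteq> c"
  shows "runs (map (\<lambda>x. (x, c)) u @ w) = (set u, c) # runs w"
  using assms(1)
proof (induction u rule: list_nonempty_induct)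
  case (single x)
  show ?case
  proof (cases w)
    case (Cons p w')
    with assms(2) snd_hd_runs[of w] show ?thesis by (auto split: list.split)
  qed simp
qed simp

text \<open>Converse of \<open>runs_append\<close>. That \<open>w'\<close> starts with another color
  is not part of the conclusion; it is recovered later from alternation.\<close>

lemma runs_ConsD:
  "runs w = (B, c) # \<tau> \<Longrightarrow> \<exists>u w'. w = map (\<lambda>x. (x, c)) u @ w' \<and> u \<noteq> [] \<and> set u = B \<and> runs w' = \<tau>"
proof (induction w arbitrary: B c \<tau> rule: runs.induct)
  case (2 x d w)
  show ?case
  proof (cases "runs w")
    case Nil
    then show ?thesis using 2 by (intro exI[of _ "[x]"] exI[of _ "[]"]) auto
  next
    case (Cons p \<tau>')
    obtain B' c' where p: "p = (B', c')" by force
    show ?thesis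
    proof (cases "d = c'")
      case True
      obtain u w' where "w = map (\<lambda>x. (x, c')) u @ w'" "set u = B'" "runs w' = \<tau>'"
        using 2(1)[of B' c' \<tau>'] Cons p by auto
      then show ?thesis
        using 2(2) Cons p True by (intro exI[of _ "x # u"] exI[of _ w']) auto
    next
      case False
      then show ?thesis
        using 2(2) Cons p by (intro exI[of _ "[x]"] exI[of _ w]) auto
    qed
  qed
qed simp

text \<open>A word with these runs is an arbitrary ordering of the first block followed by a word
  with the remaining runs, and by \<open>colored_weight_append\<close> the weight is multiplicative
  for this splitting.\<close>

lemma sum_colored_weight_runs:
  fixes \<tau> :: "(nat set \<times> 'c) list" and t :: "'b::comm_ring_1"
  assumes "\<forall>p\<in>set \<tau>. fst p \<noteq> {}" "sorted_wrt (\<lambda>p q. fst p \<inter> fst q = {}) \<tau>" "alternating \<tau>"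
  shows "(\<Sum>w | distinct (map fst w) \<and> runs w = \<tau>. colored_weight t w) =
    (\<Prod>p\<leftarrow>\<tau>. \<Sum>u\<in>permutations_of_set (fst p). descent_weight t u)"
  using assms
proof (induction \<tau>)
  case Nil
  have "(\<Sum>w | distinct (map fst (w :: (nat \<times> 'c) list)) \<and> runs w = []. colored_weight t w) =
      (\<Sum>w\<in>{[] :: (nat \<times> 'c) list}. colored_weight t w)"
    by (rule sum.cong) auto
  then show ?case unfolding list.map prod_list.Nil by simp
next
  case (Cons p \<tau>)
  obtain B c where p: "p = (B, c)" by force
  define W where "W = {w :: (nat \<times> 'c) list. distinct (map fst w) \<and> runs w = \<tau>}"
  define j where "j = (\<lambda>(u, w). map (\<lambda>x. (x :: nat, c)) u @ w)"
  have B: "B \<noteq> {}" "B \<inter> \<Union>(fst ` set \<tau>) = {}"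
    using Cons.prems p by auto
  \<comment> \<open>Alternation enters here: gluing a run of color \<open>c\<close> in front of
    \<open>w\<close> cannot merge it with the first run of \<open>w\<close>.\<close>
  have hd: "snd (hd w) \<noteq> c" if "runs w = \<tau>" "w \<noteq> []" for w :: "(nat \<times> 'c) list"
    using Cons.prems(3) that snd_hd_runs[of w] p by (auto simp: alternating_Cons)
  have "(\<Sum>w | distinct (map fst w) \<and> runs w = p # \<tau>. colored_weight t w) =
      (\<Sum>(u, w)\<in>permutations_of_set B \<times> W. descent_weight t u * colored_weight t w)"
  \<comment> \<open>The first run orders \<open>B\<close> without repetition, so it ends after
    \<open>card B\<close> letters.\<close>
  proof (rule sum.reindex_bij_witness[where j = "\<lambda>w. (map fst (take (card B) w), drop (card B) w)"
        and i = j])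
    fix v assume "v \<in> {w. distinct (map fst w) \<and> runs w = p # \<tau>}"
    then have v: "distinct (map fst v)" "runs v = (B, c) # \<tau>" using p by auto
    from runs_ConsD[OF v(2)] obtain u w
      where uw: "v = map (\<lambda>x. (x, c)) u @ w" "u \<noteq> []" "set u = B" "runs w = \<tau>" by blast
    have d: "distinct u" "distinct (map fst w)"
      using v(1) uw by (auto simp: o_def)
    then have "length u = card B" using uw by (metis distinct_card)
    then have eq: "(map fst (take (card B) v), drop (card B) v) = (u, w)"
      using uw by (simp add: o_def)
    show "j (map fst (take (card B) v), drop (card B) v) = v"
      "(map fst (take (card B) v), drop (card B) v) \<in> permutations_of_set B \<times> W"
      unfolding eq using uw d by (auto simp: j_def W_def permutations_of_set_def)
    show "(case (map fst (take (card B) v), drop (card B) v) of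
        (u, w) \<Rightarrow> descent_weight t u * colored_weight t w) = colored_weight t v"
      unfolding eq using uw hd[of w] by (simp add: colored_weight_append)
  next
    fix q assume "q \<in> permutations_of_set B \<times> W"
    then obtain u w where q: "q = (u, w)" "set u = B" "distinct u" "distinct (map fst w)" "runs w = \<tau>"
      by (auto simp: W_def dest: permutations_of_setD)
    have "length u = card B" using q by (metis distinct_card)
    then show "(map fst (take (card B) (j q)), drop (card B) (j q)) = q"
      using q by (simp add: j_def o_def)
    have "B \<inter> fst ` set w = {}"
      using B(2) Union_runs[of w] q by simp
    moreover have "u \<noteq> []" using q B by auto
    ultimately show "j q \<in> {w. distinct (map fst w) \<and> runs w = p # \<tau>}"
      using q p hd[of w] by (auto simp: j_def o_def runs_append)
  qed
  also have "\<dots> = (\<Sum>u\<in>permutations_of_set B. descent_weight t u) * (\<Sum>w\<in>W. colored_weight t w)"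
    by (simp add: sum_product sum.cartesian_product)
  also have "(\<Sum>w\<in>W. colored_weight t w) =
      (\<Prod>p\<leftarrow>\<tau>. \<Sum>u\<in>permutations_of_set (fst p). descent_weight t u)"
    unfolding W_def using Cons by (simp add: alternating_Cons)
  finally show ?case using p by simp
qed

text \<open>Trades indices for predicates on lists, which suit induction on the list of
  blocks.\<close>

lemma colored_ordered_set_partitions_iff:
  "\<tau> \<in> colored_ordered_set_partitions n C \<beta> \<longleftrightarrow>
     (\<forall>p\<in>set \<tau>. fst p \<noteq> {} \<and> snd p \<in> C) \<and> sorted_wrt (\<lambda>p q. fst p \<inter> fst q = {}) \<tau> \<and>
     \<Union>(fst ` set \<tau>) = {1..n} \<and> \<tau> \<noteq> [] \<and> snd (last \<tau>) = \<beta>"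
proof -
  have "(\<forall>i < length \<tau>. \<forall>j < length \<tau>. i \<noteq> j \<longrightarrow> fst (\<tau> ! i) \<inter> fst (\<tau> ! j) = {}) \<longleftrightarrow>
      sorted_wrt (\<lambda>p q. fst p \<inter> fst q = {}) \<tau>"
    unfolding sorted_wrt_iff_nth_less
  proof (intro iffI allI impI)
    fix i j
    assume disj: "\<forall>i j. i < j \<longrightarrow> j < length \<tau> \<longrightarrow> fst (\<tau> ! i) \<inter> fst (\<tau> ! j) = {}"
      and ij: "i < length \<tau>" "j < length \<tau>" "i \<noteq> j"
    show "fst (\<tau> ! i) \<inter> fst (\<tau> ! j) = {}"
      using disj[rule_format, of i j] disj[rule_format, of j i] ij
      by (cases i j rule: linorder_cases) (simp_all add: Int_commute)
  qed auto
  moreover have "(\<Union>j < length \<tau>. fst (\<tau> ! j)) = \<Union>(fst ` set \<tau>)"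
    unfolding set_conv_nth by blast
  ultimately show ?thesis
    unfolding colored_ordered_set_partitions_def by (auto simp: all_set_conv_all_nth)
qed

lemma finite_colored_ordered_set_partitions:
  assumes "finite C"
  shows "finite (colored_ordered_set_partitions n C \<beta>)"
proof (rule finite_subset)
  show "finite {\<tau>. set \<tau> \<subseteq> Pow {1..n} \<times> C \<and> distinct \<tau>}"
    using assms by (intro finite_subset_distinct) auto
  show "colored_ordered_set_partitions n C \<beta> \<subseteq> {\<tau>. set \<tau> \<subseteq> Pow {1..n} \<times> C \<and> distinct \<tau>}"
  proof
    fix \<tau> assume "\<tau> \<in> colored_ordered_set_partitions n C \<beta>"
    then have \<tau>: "\<forall>p\<in>set \<tau>. fst p \<noteq> {} \<and> snd p \<in> C" "\<Union>(fst ` set \<tau>) = {1..n}"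
      "sorted_wrt (\<lambda>p q. fst p \<inter> fst q = {}) \<tau>"
      by (auto simp: colored_ordered_set_partitions_iff)
    have "distinct \<tau>"
      using \<tau>(1,3) by (induction \<tau>) auto
    then show "\<tau> \<in> {\<tau>. set \<tau> \<subseteq> Pow {1..n} \<times> C \<and> distinct \<tau>}"
      using \<tau>(1) \<tau>(2)[symmetric] by (auto simp: mem_Times_iff)
  qed
qed

lemma finite_colored_permutations:
  assumes "finite C"
  shows "finite (colored_permutations n C \<beta>)"
proof (rule finite_subset)
  show "finite {w. set w \<subseteq> {1..n} \<times> C \<and> distinct w}"
    using assms by (intro finite_subset_distinct) auto
  show "colored_permutations n C \<beta> \<subseteq> {w. set w \<subseteq> {1..n} \<times> C \<and> distinct w}"
  proof
    fix w assume "w \<in> colored_permutations n C \<beta>"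
    then have "distinct (map fst w)" "fst ` set w = {1..n}" "snd ` set w \<subseteq> C"
      by (simp_all add: colored_permutations_def)
    then show "w \<in> {w. set w \<subseteq> {1..n} \<times> C \<and> distinct w}"
      using subset_fst_snd[of "set w"] by (auto simp: distinct_map)
  qed
qed

lemma sum_colored_weight:
  assumes "finite C"
  shows "(\<Sum>w\<in>colored_permutations n C \<beta>. colored_weight t w) =
    (\<Sum>\<tau> | \<tau> \<in> colored_ordered_set_partitions n C \<beta> \<and> alternating \<tau>.
      \<Prod>p\<leftarrow>\<tau>. \<Sum>u\<in>permutations_of_set (fst p). descent_weight t u)"
proof -
  let ?T = "{\<tau>. \<tau> \<in> colored_ordered_set_partitions n C \<beta> \<and> alternating \<tau>}"
  \<comment> \<open>Every condition on the word translates into one on its runs; in particular the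
    last letter and the last block have the same color. Alternation of the runs is
    automatic.\<close>
  have runs_iff: "w \<in> colored_permutations n C \<beta> \<longleftrightarrow>
      distinct (map fst w) \<and> runs w \<in> colored_ordered_set_partitions n C \<beta>" for w
  proof -
    have "(\<forall>p\<in>set (runs w). fst p \<noteq> {} \<and> snd p \<in> C) \<longleftrightarrow> snd ` set w \<subseteq> C"
      unfolding snd_set_runs[of w, symmetric] image_subset_iff using runs_nonempty[of _ w] by metis
    then show ?thesis
      unfolding colored_permutations_def colored_ordered_set_partitions_iff Union_runs
      using disjoint_runs[of w] snd_last_runs[of w] by (cases "w = []") (simp, simp, blast)
  qed
  have "(\<Sum>w\<in>colored_permutations n C \<beta>. colored_weight t w) =
      (\<Sum>\<tau>\<in>?T. \<Sum>w | w \<in> colored_permutations n C \<beta> \<and> runs w = \<tau>. colored_weight t w)"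
    by (subst sum.group)
      (use assms in \<open>auto simp: finite_colored_permutations finite_colored_ordered_set_partitions
        runs_iff alternating_runs\<close>)
  also have "\<dots> = (\<Sum>\<tau>\<in>?T. \<Prod>p\<leftarrow>\<tau>. \<Sum>u\<in>permutations_of_set (fst p). descent_weight t u)"
  proof (rule sum.cong)
    fix \<tau> assume \<tau>: "\<tau> \<in> ?T"
    then have "{w. w \<in> colored_permutations n C \<beta> \<and> runs w = \<tau>} =
        {w. distinct (map fst w) \<and> runs w = \<tau>}"
      by (auto simp: runs_iff)
    then show "(\<Sum>w | w \<in> colored_permutations n C \<beta> \<and> runs w = \<tau>. colored_weight t w) =
        (\<Prod>p\<leftarrow>\<tau>. \<Sum>u\<in>permutations_of_set (fst p). descent_weight t u)"
      using \<tau> by (simp add: sum_colored_weight_runs colored_ordered_set_partitions_iff)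
  qed simp
  finally show ?thesis .
qed

section \<open>Faces of polyhedra\<close>

text \<open>The ambient space may be infinite-dimensional, hence the subspace \<open>M\<close>.
  Equations are kept among the inequalities, marked by \<open>J\<close>, so they are tight at every
  point and need no separate treatment in the description of faces.\<close>

locale polyhedron_in_subspace =
  fixes M :: "'v::real_vector set" and I J :: "'i set" and l :: "'i \<Rightarrow> 'v \<Rightarrow> real" and b :: "'i \<Rightarrow> real"
  assumes subspace_M: "subspace M" and finite_I: "finite I" and J_subset: "J \<subseteq> I"
    and linear_l: "\<And>i. i \<in> I \<Longrightarrow> linear (l i)"
begin

definition polyhedron_set :: "'v set" where
  "polyhedron_set = {x \<in> M. (\<forall>i\<in>I. b i \<le> l i x) \<and> (\<forall>i\<in>J. l i x = b i)}"

definition tight :: "'v \<Rightarrow> 'i set" where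
  "tight x = {i \<in> I. l i x = b i}"

definition tight_face :: "'i set \<Rightarrow> 'v set" where
  "tight_face T = {x \<in> polyhedron_set. T \<subseteq> tight x}"

lemma finite_tight: "finite (tight x)"
  using finite_I by (simp add: tight_def)

lemma l_add: "i \<in> I \<Longrightarrow> l i (x + y) = l i x + l i y"
  and l_diff: "i \<in> I \<Longrightarrow> l i (x - y) = l i x - l i y"
  and l_scale: "i \<in> I \<Longrightarrow> l i (r *\<^sub>R x) = r * l i x"
  using linear_l[of i] by (simp_all add: linear_add linear_diff linear_scale)

lemma l_segment:
  assumes "i \<in> I"
  shows "l i ((1 - u) *\<^sub>R x + u *\<^sub>R y) - b i = (1 - u) * (l i x - b i) + u * (l i y - b i)"
  unfolding l_add[OF assms] l_scale[OF assms] by (simp add: algebra_simps)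

lemma segment_mem_polyhedron_set:
  assumes "x \<in> polyhedron_set" "y \<in> polyhedron_set" "0 \<le> u" "u \<le> 1"
  shows "(1 - u) *\<^sub>R x + u *\<^sub>R y \<in> polyhedron_set"
proof -
  let ?z = "(1 - u) *\<^sub>R x + u *\<^sub>R y"
  have "?z \<in> M"
    using assms subspace_M
    by (auto simp: polyhedron_set_def intro!: subspace_add subspace_scale)
  moreover have "b i \<le> l i ?z" if "i \<in> I" for i
  proof -
    have "0 \<le> (1 - u) * (l i x - b i) + u * (l i y - b i)"
      using assms that by (intro add_nonneg_nonneg mult_nonneg_nonneg) (auto simp: polyhedron_set_def)
    then show ?thesis using l_segment[OF that, of u x y] by linarith
  qed
  moreover have "l i ?z = b i" if "i \<in> J" for i
    using l_segment[of i u x y] assms that J_subset by (auto simp: polyhedron_set_def)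
  ultimately show ?thesis by (simp add: polyhedron_set_def)
qed

text \<open>The slack of each inequality is affine along the segment and nonnegative at both ends,
  so it vanishes at an inner point only if it vanishes at both ends.\<close>

lemma tight_segment:
  assumes "x \<in> polyhedron_set" "y \<in> polyhedron_set" "0 < u" "u < 1"
  shows "tight ((1 - u) *\<^sub>R x + u *\<^sub>R y) = tight x \<inter> tight y"
proof -
  have "l i ((1 - u) *\<^sub>R x + u *\<^sub>R y) = b i \<longleftrightarrow> l i x = b i \<and> l i y = b i" if "i \<in> I" for i
  proof -
    have "0 \<le> (1 - u) * (l i x - b i)" "0 \<le> u * (l i y - b i)"
      using assms that by (auto simp: polyhedron_set_def)
    then have "(1 - u) * (l i x - b i) + u * (l i y - b i) = 0 \<longleftrightarrow> l i x = b i \<and> l i y = b i"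
      using assms by (simp add: add_nonneg_eq_0_iff)
    then show ?thesis using l_segment[OF that, of u x y] by (metis right_minus_eq)
  qed
  then show ?thesis by (auto simp: tight_def)
qed

text \<open>A direction annihilated by the tight functionals only affects inequalities with positive
  slack, and there are finitely many of these.\<close>

lemma perturb:
  assumes x: "x \<in> polyhedron_set" and d: "d \<in> M" "\<forall>i\<in>tight x. l i d = 0"
  obtains e where "e > 0" "x + e *\<^sub>R d \<in> polyhedron_set" "tight x \<subseteq> tight (x + e *\<^sub>R d)"
proof -
  \<comment> \<open>The summand \<open>1\<close> in the denominator avoids division by zero, and the
    inserted \<open>1\<close> covers the case that every inequality is tight.\<close>
  define e where "e = Min (insert 1 ((\<lambda>i. (l i x - b i) / (1 + \<bar>l i d\<bar>)) ` (I - tight x)))"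
  have fin: "finite (insert 1 ((\<lambda>i. (l i x - b i) / (1 + \<bar>l i d\<bar>)) ` (I - tight x)))"
    using finite_I by simp
  have slack: "0 < l i x - b i" if "i \<in> I - tight x" for i
  proof -
    have "b i \<le> l i x" "l i x \<noteq> b i"
      using x that by (auto simp: polyhedron_set_def tight_def)
    then show ?thesis by linarith
  qed
  have e: "e > 0"
    unfolding e_def using fin slack by (subst Min_gr_iff) (auto intro!: divide_pos_pos)
  have "b i \<le> l i (x + e *\<^sub>R d)" if i: "i \<in> I - tight x" for i
  proof -
    have "e \<le> (l i x - b i) / (1 + \<bar>l i d\<bar>)"
      unfolding e_def by (rule Min_le[OF fin]) (use i in auto)
    then have "e * (1 + \<bar>l i d\<bar>) \<le> l i x - b i"
      by (simp add: pos_le_divide_eq add_pos_nonneg)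
    moreover have "- (e * l i d) \<le> e * \<bar>l i d\<bar>"
      using e by (simp add: abs_if)
    ultimately have "b i \<le> l i x + e * l i d" using e by (simp add: distrib_left)
    then show ?thesis using i by (simp add: l_add l_scale)
  qed
  moreover have eq: "l i (x + e *\<^sub>R d) = b i" if "i \<in> tight x" for i
    using d that by (simp add: tight_def l_add l_scale)
  ultimately have "\<forall>i\<in>I. b i \<le> l i (x + e *\<^sub>R d)"
    by (metis DiffI order_refl)
  moreover have "J \<subseteq> tight x"
    using x J_subset by (auto simp: polyhedron_set_def tight_def)
  moreover have "x + e *\<^sub>R d \<in> M"
    using x d subspace_M by (auto simp: polyhedron_set_def intro!: subspace_add subspace_scale)
  ultimately have "x + e *\<^sub>R d \<in> polyhedron_set"
    using eq by (auto simp: polyhedron_set_def)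
  moreover have "tight x \<subseteq> tight (x + e *\<^sub>R d)"
    using eq by (auto simp: tight_def)
  ultimately show thesis using e that by blast
qed

lemma tight_face_face_of: "tight_face T face_of polyhedron_set"
  unfolding face_of_def
proof (intro conjI ballI impI)
  show "tight_face T \<subseteq> polyhedron_set" by (auto simp: tight_face_def)
  show "convex (tight_face T)"
    unfolding convex_alt
  proof (intro ballI allI impI, elim conjE)
    fix x y and u :: real
    assume *: "x \<in> tight_face T" "y \<in> tight_face T" "0 \<le> u" "u \<le> 1"
    then have "tight x \<inter> tight y \<subseteq> tight ((1 - u) *\<^sub>R x + u *\<^sub>R y)"
      using tight_segment[of x y u] by (cases "u = 0 \<or> u = 1") (auto simp: tight_face_def)
    then show "(1 - u) *\<^sub>R x + u *\<^sub>R y \<in> tight_face T"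
      using * segment_mem_polyhedron_set[of x y u] by (auto simp: tight_face_def)
  qed
  fix x y z
  assume *: "x \<in> polyhedron_set" "y \<in> polyhedron_set" "z \<in> tight_face T" "z \<in> open_segment x y"
  then obtain u where "0 < u" "u < 1" "z = (1 - u) *\<^sub>R x + u *\<^sub>R y"
    by (auto simp: in_segment)
  then have "tight z = tight x \<inter> tight y" using * tight_segment by simp
  then show "x \<in> tight_face T" "y \<in> tight_face T"
    using * by (auto simp: tight_face_def)
qed

text \<open>
  A point of a face with as few tight inequalities as possible lies in its relative interior,
  so that the inequalities tight at this point determine the face.
\<close>

lemma face_of_eq_tight_face:
  assumes F: "F face_of polyhedron_set" "F \<noteq> {}"
  obtains x where "x \<in> F" "F = tight_face (tight x)"
proof -
  obtain x where x: "x \<in> F" "\<And>y. y \<in> F \<Longrightarrow> card (tight x) \<le> card (tight y)"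
    using F(2) ex_has_least_nat[of "\<lambda>x. x \<in> F" _ "\<lambda>x. card (tight x)"] by blast
  have sub: "F \<subseteq> polyhedron_set" and conv: "convex F"
    using F by (auto simp: face_of_def)
  have "F = tight_face (tight x)"
  proof (intro equalityI subsetI)
    fix y assume y: "y \<in> F"
    have "(1 - 1/2) *\<^sub>R x + (1/2) *\<^sub>R y \<in> F"
      by (rule convexD_alt[OF conv x(1) y]) auto
    then have "card (tight x) \<le> card (tight ((1 - 1/2) *\<^sub>R x + (1/2) *\<^sub>R y))"
      by (rule x(2))
    also have "tight ((1 - 1/2) *\<^sub>R x + (1/2) *\<^sub>R y) = tight x \<inter> tight y"
      using sub x(1) y by (intro tight_segment) auto
    finally have "tight x \<inter> tight y = tight x"
      by (intro card_seteq finite_tight) auto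
    then show "y \<in> tight_face (tight x)"
      using y sub by (auto simp: tight_face_def)
  next
    fix y assume y: "y \<in> tight_face (tight x)"
    show "y \<in> F"
    proof (cases "y = x")
      case False
      have "\<forall>i\<in>tight x. l i (x - y) = 0"
        using y by (auto simp: tight_face_def tight_def l_diff)
      moreover have "x - y \<in> M"
        using x(1) sub y subspace_M
        by (auto simp: polyhedron_set_def tight_face_def intro!: subspace_diff)
      ultimately obtain e where e: "e > 0" "x + e *\<^sub>R (x - y) \<in> polyhedron_set"
        using perturb x(1) sub by (metis subsetD)
      \<comment> \<open>The segment from \<open>y\<close> to \<open>x\<close> is prolonged beyond
        \<open>x\<close> by the factor \<open>e\<close>, so \<open>x\<close> lies at the fraction
        \<open>1 / (1 + e)\<close> of the way from \<open>y\<close> to the new end.\<close>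
      let ?z = "x + e *\<^sub>R (x - y)" and ?u = "1 / (1 + e)"
      have zy: "?z - y = (1 + e) *\<^sub>R (x - y)" by (simp add: algebra_simps)
      then have "y \<noteq> ?z" using e False by auto
      moreover have "(1 - ?u) *\<^sub>R y + ?u *\<^sub>R ?z = x"
      proof -
        have "(1 - u) *\<^sub>R y + u *\<^sub>R z = y + u *\<^sub>R (z - y)" for u and z :: 'v
          by (simp add: algebra_simps)
        from this[of ?u ?z] have "(1 - ?u) *\<^sub>R y + ?u *\<^sub>R ?z = y + (?u * (1 + e)) *\<^sub>R (x - y)"
          unfolding zy by (simp only: scaleR_scaleR)
        also have "?u * (1 + e) = 1" using e by simp
        finally show ?thesis by simp
      qed
      ultimately have "x \<in> open_segment y ?z"
        using e unfolding in_segment by (intro conjI exI[of _ ?u]) auto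
      then show ?thesis
        using face_ofD[OF F(1)] e y x(1) by (auto simp: tight_face_def)
    qed (use x in simp)
  qed
  with x(1) that show thesis by blast
qed

text \<open>Injectivity: if \<open>tight x\<close> and \<open>tight y\<close> give the same face,
  then each of the two points lies in the face of the other, which yields both inclusions.\<close>

lemma bij_betw_tight_face:
  "bij_betw tight_face (tight ` polyhedron_set) {F. F face_of polyhedron_set \<and> F \<noteq> {}}"
  unfolding bij_betw_def
proof
  show "inj_on tight_face (tight ` polyhedron_set)"
    by (rule inj_onI) (auto simp: tight_face_def set_eq_iff)
  show "tight_face ` tight ` polyhedron_set = {F. F face_of polyhedron_set \<and> F \<noteq> {}}"
  proof (intro equalityI subsetI)
    fix F assume "F \<in> {F. F face_of polyhedron_set \<and> F \<noteq> {}}"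
    then obtain x where "x \<in> F" "F = tight_face (tight x)"
      using face_of_eq_tight_face by auto
    then show "F \<in> tight_face ` tight ` polyhedron_set"
      by (auto simp: tight_face_def)
  next
    fix F assume "F \<in> tight_face ` tight ` polyhedron_set"
    then obtain x where x: "x \<in> polyhedron_set" "F = tight_face (tight x)" by auto
    then have "x \<in> F" by (simp add: tight_face_def)
    then show "F \<in> {F. F face_of polyhedron_set \<and> F \<noteq> {}}"
      using x tight_face_face_of by auto
  qed
qed

text \<open>By \<open>perturb\<close>, every direction annihilated by the tight functionals is a
  multiple of a difference of two points of the face, one of them being \<open>x\<close>.\<close>

lemma affine_dimension_tight_face:
  assumes x: "x \<in> polyhedron_set"
  shows "affine_dimension (tight_face (tight x)) = dim {d \<in> M. \<forall>i\<in>tight x. l i d = 0}"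
proof -
  let ?D = "{d \<in> M. \<forall>i\<in>tight x. l i d = 0}"
  let ?A = "{y - z |y z. y \<in> tight_face (tight x) \<and> z \<in> tight_face (tight x)}"
  have "?A \<subseteq> ?D"
    using subspace_M
    by (auto simp: tight_face_def polyhedron_set_def tight_def subset_iff l_diff intro!: subspace_diff)
  moreover have "?D \<subseteq> span ?A"
  proof
    fix d assume d: "d \<in> ?D"
    then obtain e where e: "e > 0" "x + e *\<^sub>R d \<in> polyhedron_set" "tight x \<subseteq> tight (x + e *\<^sub>R d)"
      using perturb[OF x, of d] by blast
    have "x + e *\<^sub>R d \<in> tight_face (tight x)" "x \<in> tight_face (tight x)"
      using e x by (auto simp: tight_face_def)
    then have "(x + e *\<^sub>R d) - x \<in> ?A"
      by blast
    then have "(1 / e) *\<^sub>R ((x + e *\<^sub>R d) - x) \<in> span ?A"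
      by (intro span_scale span_base)
    then show "d \<in> span ?A" using e by simp
  qed
  ultimately have "span ?A = span ?D"
    by (intro subset_antisym span_mono span_minimal subspace_span)
  then show ?thesis
    unfolding affine_dimension_def by (rule real_vector.span_eq_dim)
qed

end

section \<open>Codimension of the common kernel of independent functionals\<close>

lemma dim_kernel:
  fixes l :: "'v::real_vector \<Rightarrow> real"
  assumes V: "subspace V" "V \<subseteq> span E" "finite E" and l: "linear l" and v: "v \<in> V" "l v \<noteq> 0"
  shows "dim V = Suc (dim {x \<in> V. l x = 0})"
proof -
  let ?K = "{x \<in> V. l x = 0}"
  obtain B where B: "B \<subseteq> ?K" "independent B" "?K \<subseteq> span B" "card B = dim ?K"
    using real_vector.basis_exists[of ?K] by blast
  have "subspace ?K"
    using V(1) l unfolding subspace_def by (auto simp: linear_add linear_scale linear_0)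
  then have "span B \<subseteq> ?K" using B(1) by (simp add: span_minimal)
  then have notin: "v \<notin> span B" using v by auto
  have "finite B"
    using real_vector.independent_span_bound[OF V(3) B(2)] B(1) V(2) by blast
  have "V \<subseteq> span (insert v B)"
  proof
    fix x assume x: "x \<in> V"
    have "x - (l x / l v) *\<^sub>R v \<in> ?K"
      using x v V(1) l by (auto intro!: subspace_diff subspace_scale simp: linear_diff linear_scale)
    then show "x \<in> span (insert v B)"
      using B(3) unfolding span_breakdown_eq by blast
  qed
  moreover have "independent (insert v B)"
    using notin B(2) by (rule real_vector.independent_insertI)
  moreover have "v \<notin> B" using notin span_base by blast
  then have "card (insert v B) = Suc (dim ?K)"
    using \<open>finite B\<close> B(4) by simp
  ultimately show ?thesis
    using B(1) v(1) by (intro real_vector.dim_unique[of "insert v B"]) auto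
qed

text \<open>The functionals are imposed in order of increasing rank. The witness for
  \<open>i\<close> is annihilated by all those imposed before, so each new one lowers the dimension
  by exactly one. The hypothesis is a triangular certificate of linear independence on
  \<open>V\<close>.\<close>

lemma dim_common_kernel:
  fixes l :: "'i \<Rightarrow> 'v::real_vector \<Rightarrow> real" and rk :: "'i \<Rightarrow> nat"
  assumes V: "subspace V" "V \<subseteq> span E" "finite E" and "finite S"
    and l: "\<And>i. i \<in> S \<Longrightarrow> linear (l i)"
    and triangular: "\<And>i. i \<in> S \<Longrightarrow>
      \<exists>v\<in>V. l i v \<noteq> 0 \<and> (\<forall>j\<in>S. rk j \<le> rk i \<longrightarrow> j \<noteq> i \<longrightarrow> l j v = 0)"
  shows "dim {x \<in> V. \<forall>i\<in>S. l i x = 0} + card S = dim V"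
  using \<open>finite S\<close> l triangular
proof (induction S rule: finite_ranking_induct[where f = rk])
  case (insert i S)
  show ?case
  proof (cases "i \<in> S")
    case True
    then show ?thesis using insert by (simp add: insert_absorb)
  next
    case False
    let ?K = "{x \<in> V. \<forall>j\<in>S. l j x = 0}"
    have IH: "dim ?K + card S = dim V"
      using insert.prems by (intro insert.IH) (meson insertI2)+
    obtain v where "v \<in> V" "l i v \<noteq> 0" "\<forall>j\<in>S. l j v = 0"
      using insert.prems(2)[of i] insert.hyps(2) False by (metis insertI1 insertI2)
    moreover have "subspace ?K"
      using V(1) insert.prems(1) unfolding subspace_def
      by (auto simp: linear_add linear_scale linear_0)
    moreover have "?K \<subseteq> span E" using V(2) by auto
    ultimately have "dim ?K = Suc (dim {x \<in> ?K. l i x = 0})"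
      using V(3) insert.prems(1) by (intro dim_kernel[of _ E _ v]) auto
    moreover have "{x \<in> ?K. l i x = 0} = {x \<in> V. \<forall>j\<in>insert i S. l j x = 0}" by auto
    ultimately show ?thesis
      using IH False insert.hyps(1) by simp
  qed
qed simp

section \<open>The permutohedron\<close>

lemma lookup_scaleR [simp]: "Poly_Mapping.lookup (r *\<^sub>R v) i = r *\<^sub>R Poly_Mapping.lookup v i"
proof -
  have "finite {i. r *\<^sub>R Poly_Mapping.lookup v i \<noteq> 0}"
    by (rule finite_subset[of _ "{i. Poly_Mapping.lookup v i \<noteq> 0}"]) auto
  then show ?thesis by (simp add: scaleR_poly_mapping_def Abs_poly_mapping_inverse)
qed

definition triangular :: "nat \<Rightarrow> real" where
  "triangular k = real k * (real k + 1) / 2"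

lemma triangular_0 [simp]: "triangular 0 = 0"
  and triangular_Suc [simp]: "triangular (Suc k) = triangular k + real (Suc k)"
  by (simp_all add: triangular_def field_simps)

text \<open>The largest of \<open>k\<close> distinct positive integers is at least \<open>k\<close>.
  This makes Rado's inequalities valid at the vertices.\<close>

lemma triangular_le_sum:
  fixes A :: "nat set"
  assumes "finite A" "0 \<notin> A"
  shows "triangular (card A) \<le> (\<Sum>a\<in>A. real a)"
  using assms
proof (induction A rule: finite_linorder_max_induct)
  case (insert b A)
  have "A \<subseteq> {1..<b}" using insert by (auto simp: Suc_le_eq intro: gr0I)
  then have "card A \<le> b - 1" using card_mono[of "{1..<b}" A] by simp
  then have "Suc (card A) \<le> b" using insert.prems by (cases b) auto
  then have "real (Suc (card A)) \<le> real b" by simp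
  moreover have "b \<notin> A" using insert by auto
  ultimately show ?case using insert by simp
qed simp

text \<open>The difference of the two sides is \<open>(s - q) * (t - q)\<close>. It is applied to
  the sizes of a union and an intersection on one side and of two incomparable sets on the
  other.\<close>

lemma triangular_supermodular:
  assumes "p + q = s + t" "q < s" "q < t"
  shows "triangular s + triangular t < triangular p + triangular q"
proof -
  obtain i j where ij: "s = q + Suc i" "t = q + Suc j"
    using assms(2,3) by (metis less_imp_Suc_add add_Suc_right)
  then have "p = q + Suc i + Suc j" using assms(1) by simp
  then have "triangular p + triangular q - (triangular s + triangular t) = real (Suc i) * real (Suc j)"
    using ij by (simp add: triangular_def field_simps)
  moreover have "0 < real (Suc i) * real (Suc j)" by simp
  ultimately show ?thesis by linarith
qed

text \<open>The index set is arbitrary because flags are realized by induction over subsets.\<close>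

definition permutohedral :: "'a set \<Rightarrow> ('a \<Rightarrow> real) \<Rightarrow> bool" where
  "permutohedral X x \<longleftrightarrow> sum x X = triangular (card X) \<and> (\<forall>S\<subseteq>X. triangular (card S) \<le> sum x S)"

definition tight_sets :: "'a set \<Rightarrow> ('a \<Rightarrow> real) \<Rightarrow> 'a set set" where
  "tight_sets X x = {S. S \<subseteq> X \<and> sum x S = triangular (card S)}"

text \<open>Tight sets are nested because the right-hand sides are strictly supermodular.\<close>

lemma tight_sets_in_flags:
  assumes "finite X" "permutohedral X x"
  shows "tight_sets X x \<in> flags X"
proof -
  have "S \<subseteq> S' \<or> S' \<subseteq> S" if S: "S \<in> tight_sets X x" "S' \<in> tight_sets X x" for S S'
  proof (rule ccontr)
    assume nc: "\<not> (S \<subseteq> S' \<or> S' \<subseteq> S)"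
    have fin: "finite S" "finite S'"
      using S assms(1) by (auto simp: tight_sets_def intro: finite_subset)
    have "card (S \<union> S') + card (S \<inter> S') = card S + card S'"
      using card_Un_Int[OF fin] by simp
    moreover have "card (S \<inter> S') < card S" "card (S \<inter> S') < card S'"
      using nc fin by (auto intro!: psubset_card_mono)
    ultimately have "triangular (card S) + triangular (card S') <
        triangular (card (S \<union> S')) + triangular (card (S \<inter> S'))"
      by (rule triangular_supermodular)
    also have "\<dots> \<le> sum x (S \<union> S') + sum x (S \<inter> S')"
    proof -
      have "S \<union> S' \<subseteq> X" "S \<inter> S' \<subseteq> X" using S by (auto simp: tight_sets_def)
      then show ?thesis
        using assms(2) unfolding permutohedral_def by (meson add_mono)
    qed
    also have "\<dots> = sum x S + sum x S'"
      using fin by (rule sum.union_inter)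
    finally show False using S by (simp add: tight_sets_def)
  qed
  then show ?thesis
    using assms by (auto simp: flags_def chain_subset_def tight_sets_def permutohedral_def)
qed

lemma flag_realized:
  assumes "finite X" "T \<in> flags X"
  shows "\<exists>x. permutohedral X x \<and> tight_sets X x = T"
  using assms
proof (induction X arbitrary: T rule: finite_psubset_induct)
  case (psubset X)
  show ?case
  proof (cases "X = {}")
    case True
    then show ?thesis using psubset.prems
      by (auto simp: flags_empty permutohedral_def tight_sets_def)
  next
    case False
    obtain Y T' where Y: "Y \<subset> X" "T' \<in> flags Y" "T = insert X T'"
      using flags_remove_top[OF psubset.hyps False psubset.prems] .
    obtain x' where x': "permutohedral Y x'" "tight_sets Y x' = T'"
      using psubset.IH Y by blast
    \<comment> \<open>The new coordinates all equal the average of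
      \<open>card Y + 1, ..., card X\<close>, so together they contribute
      \<open>triangular (card X) - triangular (card Y)\<close>.\<close>
    define x where "x i = (if i \<in> Y then x' i else (real (card Y) + 1 + real (card X)) / 2)" for i
    have fin: "finite Y" using Y psubset.hyps finite_subset by blast
    \<comment> \<open>Both summands are nonnegative. The second one vanishes only if
      \<open>S \<subseteq> Y\<close> or \<open>S = X\<close>, so beyond the tight sets of
      \<open>x'\<close> only \<open>X\<close> becomes tight.\<close>
    have slack: "sum x S - triangular (card S) = (sum x' (S \<inter> Y) - triangular (card (S \<inter> Y))) +
        real (card (S - Y)) * (real (card Y) - real (card (S \<inter> Y)) + (real (card X) - real (card S))) / 2"
      if S: "S \<subseteq> X" for S
    proof -
      have finS: "finite S" using S psubset.hyps finite_subset by blast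
      have "sum x S = sum x (S \<inter> Y) + sum x (S - Y)"
        using finS by (metis sum.Int_Diff)
      also have "sum x (S \<inter> Y) = sum x' (S \<inter> Y)"
        by (rule sum.cong) (auto simp: x_def)
      also have "sum x (S - Y) = real (card (S - Y)) * ((real (card Y) + 1 + real (card X)) / 2)"
        by (subst sum.cong[where h = "\<lambda>_. (real (card Y) + 1 + real (card X)) / 2", OF refl])
          (auto simp: x_def)
      finally have "sum x S = sum x' (S \<inter> Y) +
          real (card (S - Y)) * ((real (card Y) + 1 + real (card X)) / 2)" .
      moreover have "real (card S) = real (card (S \<inter> Y)) + real (card (S - Y))"
        using card_Int_Diff[OF finS, of Y] by simp
      ultimately show ?thesis by (simp add: triangular_def field_simps)
    qed
    have le: "card (S \<inter> Y) \<le> card Y" "card S \<le> card X" if "S \<subseteq> X" for S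
      using that fin psubset.hyps by (auto intro: card_mono)
    have nonneg1: "0 \<le> sum x' (S \<inter> Y) - triangular (card (S \<inter> Y))" for S
      using x'(1) by (simp add: permutohedral_def)
    have nonneg2: "0 \<le> real (card (S - Y)) *
        (real (card Y) - real (card (S \<inter> Y)) + (real (card X) - real (card S))) / 2"
      if "S \<subseteq> X" for S
      using le[OF that] by (intro divide_nonneg_nonneg mult_nonneg_nonneg add_nonneg_nonneg) auto
    have tight_iff: "sum x S = triangular (card S) \<longleftrightarrow> S \<in> T" if S: "S \<subseteq> X" for S
    proof -
      have finS: "finite S" using S psubset.hyps finite_subset by blast
      have "sum x S = triangular (card S) \<longleftrightarrow> S \<inter> Y \<in> T' \<and>
          (card (S - Y) = 0 \<or> (card (S \<inter> Y) = card Y \<and> card S = card X))"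
      proof -
        have "sum x S = triangular (card S) \<longleftrightarrow>
            sum x' (S \<inter> Y) - triangular (card (S \<inter> Y)) = 0 \<and> real (card (S - Y)) *
            (real (card Y) - real (card (S \<inter> Y)) + (real (card X) - real (card S))) / 2 = 0"
          using slack[OF S] nonneg1[of S] nonneg2[OF S] by linarith
        also have "sum x' (S \<inter> Y) - triangular (card (S \<inter> Y)) = 0 \<longleftrightarrow> S \<inter> Y \<in> T'"
          unfolding x'(2)[symmetric] tight_sets_def by auto
        also have "real (card (S - Y)) *
            (real (card Y) - real (card (S \<inter> Y)) + (real (card X) - real (card S))) / 2 = 0 \<longleftrightarrow>
            card (S - Y) = 0 \<or> (card (S \<inter> Y) = card Y \<and> card S = card X)"
          using le[OF S] by auto
        finally show ?thesis .
      qed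
      also have "\<dots> \<longleftrightarrow> S \<in> T"
      proof
        assume *: "S \<inter> Y \<in> T' \<and> (card (S - Y) = 0 \<or> (card (S \<inter> Y) = card Y \<and> card S = card X))"
        show "S \<in> T"
        proof (cases "card (S - Y) = 0")
          case True
          then have "S \<inter> Y = S" using finS by auto
          then show ?thesis using * Y by simp
        next
          case False
          then have "S = X" using * S psubset.hyps by (simp add: card_subset_eq)
          then show ?thesis using Y by simp
        qed
      next
        assume "S \<in> T"
        then consider "S = X" | "S \<in> T'" using Y by auto
        then show "S \<inter> Y \<in> T' \<and> (card (S - Y) = 0 \<or> (card (S \<inter> Y) = card Y \<and> card S = card X))"
        proof cases
          case 1
          then have "S \<inter> Y = Y" using Y by auto
          then show ?thesis using 1 Y by (auto simp: flags_def)
        next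
          case 2
          then have "S \<subseteq> Y" using Y by (auto simp: flags_def)
          then have "S \<inter> Y = S" "S - Y = {}" by auto
          then show ?thesis using 2 by (simp only: card.empty) simp
        qed
      qed
      finally show ?thesis .
    qed
    have "permutohedral X x"
      unfolding permutohedral_def
    proof (intro conjI allI impI)
      show "sum x X = triangular (card X)" using tight_iff[of X] Y by simp
      show "triangular (card S) \<le> sum x S" if "S \<subseteq> X" for S
        using slack[OF that] nonneg1[of S] nonneg2[OF that] by linarith
    qed
    moreover have "tight_sets X x = T"
      using tight_iff psubset.prems by (auto simp: tight_sets_def flags_def)
    ultimately show ?thesis by blast
  qed
qed

text \<open>A flag that separates all points grows by one element at a time. Subtracting consecutive
  equations gives \<open>x i = k\<close> if \<open>i\<close> is the \<open>k\<close>-th element to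
  enter, so \<open>x\<close> lists the positions of the elements.\<close>

lemma permutohedral_separated:
  assumes x: "permutohedral {1..m} x"
    and sep: "\<And>a b. a \<in> {1..m} \<Longrightarrow> b \<in> {1..m} \<Longrightarrow> a \<noteq> b \<Longrightarrow>
      \<exists>S\<in>tight_sets {1..m} x. (a \<in> S) \<noteq> (b \<in> S)"
  shows "\<exists>p. p permutes {1..m} \<and> (\<forall>i\<in>{1..m}. x i = real (p i))"
proof -
  define T where "T = tight_sets {1..m} x"
  have T: "T \<in> flags {1..m}"
    unfolding T_def using x by (intro tight_sets_in_flags) auto
  then have T_props: "{} \<in> T" "{1..m} \<in> T" "chain_subset T" "T \<subseteq> Pow {1..m}"
    by (auto simp: flags_def)
  have finT: "finite T" using T flags_finite by blast
  \<comment> \<open>\<open>A i\<close> is the smallest tight set containing \<open>i\<close>, and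
    \<open>B i\<close> the largest one avoiding it; separation makes them differ in \<open>i\<close>
    only.\<close>
  define A where "A i = \<Inter>{S \<in> T. i \<in> S}" for i
  define B where "B i = \<Union>{S \<in> T. i \<notin> S}" for i
  have A_in: "A i \<in> T" "i \<in> A i" "A i \<subseteq> {1..m}" if i: "i \<in> {1..m}" for i
  proof -
    have "A i \<in> {S \<in> T. i \<in> S}"
      unfolding A_def using finT T_props i
      by (intro Inter_in_chain) (auto simp: subset.chain_def chain_subset_def)
    then show "A i \<in> T" "i \<in> A i" by auto
    then show "A i \<subseteq> {1..m}" using T_props by auto
  qed
  have B_in: "B i \<in> T" "i \<notin> B i" for i
  proof -
    have "B i \<in> {S \<in> T. i \<notin> S}"
      unfolding B_def using finT T_props
      by (intro Union_finite_chain_in) (auto simp: chain_subset_def)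
    then show "B i \<in> T" "i \<notin> B i" by auto
  qed
  have A_eq: "A i = insert i (B i)" if i: "i \<in> {1..m}" for i
  proof (intro equalityI subsetI)
    fix k assume k: "k \<in> A i"
    show "k \<in> insert i (B i)"
    proof (cases "k = i")
      case False
      have "k \<in> {1..m}" using k A_in i by blast
      then obtain S where S: "S \<in> T" "(i \<in> S) \<noteq> (k \<in> S)"
        using sep[of i k] i False unfolding T_def by blast
      then show ?thesis using k unfolding A_def B_def by blast
    qed simp
  next
    fix k assume "k \<in> insert i (B i)"
    then show "k \<in> A i"
    proof
      assume "k \<in> B i"
      then obtain S where S: "S \<in> T" "i \<notin> S" "k \<in> S" unfolding B_def by blast
      then have "S \<subseteq> A i"
        using A_in[OF i] T_props(3) unfolding chain_subset_def by blast
      then show ?thesis using S by blast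
    qed (use A_in i in auto)
  qed
  have x_eq: "x i = real (card (A i))" if i: "i \<in> {1..m}" for i
  proof -
    have "B i \<subseteq> {1..m}" using B_in(1)[of i] T_props(4) by blast
    then have "finite (B i)" by (rule finite_subset) simp
    then have *: "sum x (A i) = x i + sum x (B i)" "card (A i) = Suc (card (B i))"
      using B_in(2)[of i] by (simp_all add: A_eq[OF i])
    moreover have "sum x (A i) = triangular (card (A i))" "sum x (B i) = triangular (card (B i))"
      using A_in[OF i] B_in[of i] by (auto simp: T_def tight_sets_def)
    ultimately have "triangular (card (B i)) + real (Suc (card (B i))) = x i + triangular (card (B i))"
      by (metis triangular_Suc)
    then show ?thesis using *(2) by simp
  qed
  define p where "p i = (if i \<in> {1..m} then card (A i) else i)" for i
  have "inj_on p {1..m}"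
  proof (rule inj_onI, rule ccontr)
    fix i k assume *: "i \<in> {1..m}" "k \<in> {1..m}" "p i = p k" "i \<noteq> k"
    have "A i \<subseteq> A k \<or> A k \<subseteq> A i"
      using A_in * T_props(3) by (auto simp: chain_subset_def)
    moreover have "card (A i) = card (A k)" using * by (simp add: p_def)
    moreover have "finite (A i)" "finite (A k)"
      using finite_subset[OF A_in(3)[OF *(1)]] finite_subset[OF A_in(3)[OF *(2)]] by simp_all
    ultimately have eq: "A i = A k" by (metis card_subset_eq)
    obtain S where "S \<in> T" "(i \<in> S) \<noteq> (k \<in> S)" using sep[of i k] * unfolding T_def by blast
    then show False using eq A_in(2)[OF *(1)] A_in(2)[OF *(2)] unfolding A_def by blast
  qed
  moreover have "p ` {1..m} \<subseteq> {1..m}"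
  proof
    fix k assume "k \<in> p ` {1..m}"
    then obtain i where i: "i \<in> {1..m}" "k = card (A i)" by (auto simp: p_def)
    have "finite (A i)" using A_in(3)[OF i(1)] by (rule finite_subset) simp
    then have "0 < card (A i)" using A_in(2)[OF i(1)] by (auto simp: card_gt_0_iff)
    moreover have "card (A i) \<le> m" using card_mono[OF _ A_in(3)[OF i(1)]] by simp
    ultimately show "k \<in> {1..m}" using i by simp
  qed
  ultimately have "bij_betw p {1..m} {1..m}"
    by (simp add: bij_betw_def endo_inj_surj)
  then have "p permutes {1..m}"
    by (rule bij_imp_permutes) (auto simp: p_def)
  then show ?thesis using x_eq by (auto simp: p_def)
qed

section \<open>Moving a point until another inequality becomes tight\<close>

abbreviation transfer :: "nat \<Rightarrow> nat \<Rightarrow> nat \<Rightarrow>\<^sub>0 real" where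
  "transfer a b \<equiv> Poly_Mapping.single b 1 - Poly_Mapping.single a 1"

lemma sum_lookup_transfer:
  assumes "finite S"
  shows "sum (Poly_Mapping.lookup (v + c *\<^sub>R transfer a b)) S =
    sum (Poly_Mapping.lookup v) S + c * (of_bool (b \<in> S) - of_bool (a \<in> S))"
proof -
  have "sum (Poly_Mapping.lookup (transfer a b)) S = of_bool (b \<in> S) - of_bool (a \<in> S)"
    using assms by (simp add: lookup_minus lookup_single sum_subtractf when_def)
  then show ?thesis
    by (simp add: lookup_add sum.distrib flip: sum_distrib_left)
qed

definition permutohedron_halfspaces :: "nat \<Rightarrow> (nat \<Rightarrow>\<^sub>0 real) set" where
  "permutohedron_halfspaces m = {v. (\<forall>i. i \<notin> {1..m} \<longrightarrow> Poly_Mapping.lookup v i = 0) \<and>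
     permutohedral {1..m} (Poly_Mapping.lookup v)}"

text \<open>Only sets containing \<open>a\<close> but not \<open>b\<close> lose slack, and none of
  them is tight by assumption. The least of their slacks is the admissible step; the set attaining
  it becomes tight, while tight sets remain tight since they contain both or neither of
  \<open>a\<close> and \<open>b\<close>.\<close>

lemma transfer_to_tight:
  assumes v: "v \<in> permutohedron_halfspaces m"
    and ab: "a \<in> {1..m}" "b \<in> {1..m}" "a \<noteq> b"
    and sep: "\<forall>S\<in>tight_sets {1..m} (Poly_Mapping.lookup v). a \<in> S \<longleftrightarrow> b \<in> S"
  obtains c where "c > 0" "v + c *\<^sub>R transfer a b \<in> permutohedron_halfspaces m"
    "tight_sets {1..m} (Poly_Mapping.lookup v) \<subset>
     tight_sets {1..m} (Poly_Mapping.lookup (v + c *\<^sub>R transfer a b))"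
proof -
  let ?x = "Poly_Mapping.lookup v" and ?X = "{1..m}"
  define SS where "SS = {S. S \<subseteq> ?X \<and> a \<in> S \<and> b \<notin> S}"
  define slack where "slack S = sum ?x S - triangular (card S)" for S
  define c where "c = Min (slack ` SS)"
  have fin: "finite SS" by (rule finite_subset[of _ "Pow ?X"]) (auto simp: SS_def)
  have ne: "SS \<noteq> {}" using ab by (auto simp: SS_def intro!: exI[of _ "{a}"])
  have slack_nonneg: "0 \<le> slack S" if "S \<subseteq> ?X" for S
    using v that by (simp add: slack_def permutohedron_halfspaces_def permutohedral_def)
  have slack_pos: "0 < slack S" if "S \<in> SS" for S
  proof -
    have "S \<notin> tight_sets ?X ?x" using sep that by (auto simp: SS_def)
    then have "slack S \<noteq> 0" using that by (auto simp: SS_def tight_sets_def slack_def)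
    then show ?thesis using slack_nonneg[of S] that by (auto simp: SS_def)
  qed
  have c_pos: "c > 0" unfolding c_def using fin ne slack_pos by simp
  have c_le: "c \<le> slack S" if "S \<in> SS" for S unfolding c_def using fin that by simp
  have "c \<in> slack ` SS" unfolding c_def using fin ne by (intro Min_in) auto
  then obtain S0 where S0: "S0 \<in> SS" "slack S0 = c" by auto
  let ?w = "v + c *\<^sub>R transfer a b"
  have new_slack: "sum (Poly_Mapping.lookup ?w) S - triangular (card S) =
      slack S + c * (of_bool (b \<in> S) - of_bool (a \<in> S))" if "S \<subseteq> ?X" for S
  proof -
    have "finite S" using that by (rule finite_subset) simp
    from sum_lookup_transfer[OF this, of v c b a] show ?thesis by (simp add: slack_def)
  qed
  have "0 \<le> slack S + c * (of_bool (b \<in> S) - of_bool (a \<in> S))" if "S \<subseteq> ?X" for S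
    using slack_nonneg[OF that] c_pos c_le[of S] that by (auto simp: SS_def)
  then have ge: "triangular (card S) \<le> sum (Poly_Mapping.lookup ?w) S" if "S \<subseteq> ?X" for S
    using new_slack[OF that] that by (metis diff_ge_0_iff_ge)
  have tight: "S \<in> tight_sets ?X (Poly_Mapping.lookup ?w)" if "S \<in> tight_sets ?X ?x" for S
  proof -
    have "S \<subseteq> ?X" "slack S = 0" "a \<in> S \<longleftrightarrow> b \<in> S"
      using that sep by (auto simp: tight_sets_def slack_def)
    then show ?thesis using new_slack[of S] by (simp add: tight_sets_def)
  qed
  have "?X \<in> tight_sets ?X ?x"
    using v by (simp add: tight_sets_def permutohedron_halfspaces_def permutohedral_def)
  from tight[OF this] ge have "permutohedral ?X (Poly_Mapping.lookup ?w)"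
    unfolding permutohedral_def by (simp add: tight_sets_def)
  moreover have "Poly_Mapping.lookup ?w i = 0" if "i \<notin> ?X" for i
  proof -
    have "i \<noteq> a" "i \<noteq> b" using ab that by auto
    then show ?thesis
      using v that by (simp add: permutohedron_halfspaces_def lookup_add lookup_minus lookup_single)
  qed
  ultimately have "?w \<in> permutohedron_halfspaces m"
    by (auto simp: permutohedron_halfspaces_def)
  moreover have "S0 \<in> tight_sets ?X (Poly_Mapping.lookup ?w)" "S0 \<notin> tight_sets ?X ?x"
    using new_slack[of S0] S0 slack_pos[of S0] by (auto simp: SS_def tight_sets_def slack_def)
  ultimately show thesis
    using that[OF c_pos] tight by blast
qed

lemma convex_permutohedron_halfspaces: "convex (permutohedron_halfspaces m)"
  unfolding convex_alt
proof (intro ballI allI impI, elim conjE)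
  fix v w and u :: real
  assume *: "v \<in> permutohedron_halfspaces m" "w \<in> permutohedron_halfspaces m" "0 \<le> u" "u \<le> 1"
  have sum_eq: "sum (Poly_Mapping.lookup ((1 - u) *\<^sub>R v + u *\<^sub>R w)) S =
      (1 - u) * sum (Poly_Mapping.lookup v) S + u * sum (Poly_Mapping.lookup w) S" for S
    by (simp add: lookup_add sum.distrib sum_distrib_left)
  have "triangular (card S) \<le> (1 - u) * sum (Poly_Mapping.lookup v) S + u * sum (Poly_Mapping.lookup w) S"
    if "S \<subseteq> {1..m}" for S
  proof -
    have "triangular (card S) = (1 - u) * triangular (card S) + u * triangular (card S)"
      by (simp add: algebra_simps)
    also have "\<dots> \<le> (1 - u) * sum (Poly_Mapping.lookup v) S + u * sum (Poly_Mapping.lookup w) S"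
      using * that by (intro add_mono mult_left_mono)
        (auto simp: permutohedron_halfspaces_def permutohedral_def)
    finally show ?thesis .
  qed
  then have "permutohedral {1..m} (Poly_Mapping.lookup ((1 - u) *\<^sub>R v + u *\<^sub>R w))"
    using * unfolding permutohedral_def sum_eq
    by (simp add: permutohedron_halfspaces_def permutohedral_def left_diff_distrib)
  then show "(1 - u) *\<^sub>R v + u *\<^sub>R w \<in> permutohedron_halfspaces m"
    using * by (simp add: permutohedron_halfspaces_def lookup_add)
qed

text \<open>
  Rado's description of the permutohedron.  A point at which two coordinates \<open>a\<close>, \<open>b\<close> are not
  separated by any tight set can be moved in both directions \<open>\<plusminus>(e\<^sub>b - e\<^sub>a)\<close> until a new inequality
  becomes tight; a point without such a pair of coordinates is a permutation.
\<close>

lemma permutohedron_eq_halfspaces: "permutohedron m = permutohedron_halfspaces m"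
proof
  show "permutohedron m \<subseteq> permutohedron_halfspaces m"
    unfolding permutohedron_def
  proof (rule hull_minimal[OF subsetI])
    fix v assume "v \<in> {v. \<exists>p. p permutes {1..m} \<and>
     (\<forall>i. Poly_Mapping.lookup v i = (if i \<in> {1..m} then real (p i) else 0))}"
    then obtain p where p: "p permutes {1..m}"
      "\<And>i. Poly_Mapping.lookup v i = (if i \<in> {1..m} then real (p i) else 0)" by auto
    have sum_eq: "sum (Poly_Mapping.lookup v) S = (\<Sum>k\<in>p ` S. real k)" "card (p ` S) = card S"
      if "S \<subseteq> {1..m}" for S
    proof -
      have inj: "inj_on p S" using p(1) permutes_inj_on by blast
      have "sum (Poly_Mapping.lookup v) S = (\<Sum>i\<in>S. real (p i))"
        using p(2) that by (intro sum.cong) auto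
      then show "sum (Poly_Mapping.lookup v) S = (\<Sum>k\<in>p ` S. real k)"
        using inj by (simp add: sum.reindex)
      show "card (p ` S) = card S" using inj by (rule card_image)
    qed
    have "triangular (card S) \<le> sum (Poly_Mapping.lookup v) S" if S: "S \<subseteq> {1..m}" for S
    proof -
      have "p ` S \<subseteq> {1..m}" using S permutes_image[OF p(1)] by blast
      then have "finite (p ` S)" "0 \<notin> p ` S" by (auto intro: finite_subset)
      from triangular_le_sum[OF this] show ?thesis using sum_eq[OF S] by simp
    qed
    moreover have "sum (Poly_Mapping.lookup v) {1..m} = triangular m"
    proof -
      have "(\<Sum>k\<in>{1..m}. real k) = triangular m" by (induction m) auto
      then show ?thesis using sum_eq(1)[of "{1..m}"] permutes_image[OF p(1)] by simp
    qed
    ultimately show "v \<in> permutohedron_halfspaces m"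
      using p(2) by (simp add: permutohedron_halfspaces_def permutohedral_def)
  qed (rule convex_permutohedron_halfspaces)
next
  have "v \<in> permutohedron m" if "v \<in> permutohedron_halfspaces m" for v
    using that
  \<comment> \<open>The measure is the number of subsets that are not tight; it drops with each
    move.\<close>
  proof (induction "card (Pow {1..m} - tight_sets {1..m} (Poly_Mapping.lookup v))"
      arbitrary: v rule: less_induct)
    case less
    let ?T = "\<lambda>v. tight_sets {1..m} (Poly_Mapping.lookup v)"
    have IH: "w \<in> permutohedron m" if "w \<in> permutohedron_halfspaces m" "?T v \<subset> ?T w" for w
    proof (rule less.hyps[OF _ that(1)])
      have "?T w \<subseteq> Pow {1..m}" by (auto simp: tight_sets_def)
      then have "Pow {1..m} - ?T w \<subset> Pow {1..m} - ?T v"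
        using that(2) by blast
      then show "card (Pow {1..m} - ?T w) < card (Pow {1..m} - ?T v)"
        by (intro psubset_card_mono) auto
    qed
    show ?case
    proof (cases "\<exists>a\<in>{1..m}. \<exists>b\<in>{1..m}. a \<noteq> b \<and> (\<forall>S\<in>?T v. a \<in> S \<longleftrightarrow> b \<in> S)")
      case True
      then obtain a b where ab: "a \<in> {1..m}" "b \<in> {1..m}" "a \<noteq> b"
        "\<forall>S\<in>?T v. a \<in> S \<longleftrightarrow> b \<in> S" by blast
      obtain c where c: "c > 0" "v + c *\<^sub>R transfer a b \<in> permutohedron_halfspaces m"
        "?T v \<subset> ?T (v + c *\<^sub>R transfer a b)"
        using transfer_to_tight[OF less.prems ab] .
      obtain d where d: "d > 0" "v + d *\<^sub>R transfer b a \<in> permutohedron_halfspaces m"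
        "?T v \<subset> ?T (v + d *\<^sub>R transfer b a)"
        using transfer_to_tight[OF less.prems ab(2,1)] ab(3,4) by metis
      \<comment> \<open>The two displacements are opposite, of lengths \<open>c\<close> and
        \<open>d\<close>; this weight gives \<open>(1 - ?u) * c = ?u * d\<close>, so they
        cancel.\<close>
      let ?u = "c / (c + d)"
      have "(1 - ?u) *\<^sub>R (v + c *\<^sub>R transfer a b) + ?u *\<^sub>R (v + d *\<^sub>R transfer b a) \<in> permutohedron m"
        using IH[OF c(2,3)] IH[OF d(2,3)] c d
        by (intro convexD_alt) (auto simp: permutohedron_def convex_convex_hull)
      moreover have "(1 - ?u) *\<^sub>R (v + c *\<^sub>R transfer a b) + ?u *\<^sub>R (v + d *\<^sub>R transfer b a) = v"
      proof (rule poly_mapping_eqI)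
        fix i
        have "(1 - ?u) * c = ?u * d" using c d by (simp add: field_simps)
        then have "y + ((1 - ?u) * c - ?u * d) * z = y" for y z by simp
        moreover have "(1 - u) * (y + c * z) + u * (y + d * - z) = y + ((1 - u) * c - u * d) * z"
          for u y z :: real
          by (simp add: algebra_simps)
        ultimately have "(1 - ?u) * (y + c * z) + ?u * (y + d * - z) = y" for y z
          by metis
        from this[of "Poly_Mapping.lookup v i" "Poly_Mapping.lookup (transfer a b) i"]
        show "Poly_Mapping.lookup ((1 - ?u) *\<^sub>R (v + c *\<^sub>R transfer a b) +
            ?u *\<^sub>R (v + d *\<^sub>R transfer b a)) i = Poly_Mapping.lookup v i"
          by (simp add: lookup_add lookup_minus)
      qed
      ultimately show ?thesis by simp
    next
      case False
      have v: "\<forall>i. i \<notin> {1..m} \<longrightarrow> Poly_Mapping.lookup v i = 0"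
        "permutohedral {1..m} (Poly_Mapping.lookup v)"
        using less.prems by (auto simp: permutohedron_halfspaces_def)
      have sep: "\<exists>S\<in>?T v. (a \<in> S) \<noteq> (b \<in> S)"
        if "a \<in> {1..m}" "b \<in> {1..m}" "a \<noteq> b" for a b
        using False that by metis
      obtain p where "p permutes {1..m}" "\<forall>i\<in>{1..m}. Poly_Mapping.lookup v i = real (p i)"
        using permutohedral_separated[OF v(2) sep] by blast
      then show ?thesis
        unfolding permutohedron_def using v(1) by (intro hull_inc) auto
    qed
  qed
  then show "permutohedron_halfspaces m \<subseteq> permutohedron m" by blast
qed

section \<open>Products of permutohedra\<close>

definition product_space :: "nat list \<Rightarrow> (nat \<Rightarrow>\<^sub>0 nat \<Rightarrow>\<^sub>0 real) set" where
  "product_space cs = {x. (\<forall>j\<ge>length cs. Poly_Mapping.lookup x j = 0) \<and>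
     (\<forall>j<length cs. \<forall>i. i \<notin> {1..cs ! j} \<longrightarrow> Poly_Mapping.lookup (Poly_Mapping.lookup x j) i = 0)}"

definition block_sum :: "nat \<times> nat set \<Rightarrow> (nat \<Rightarrow>\<^sub>0 nat \<Rightarrow>\<^sub>0 real) \<Rightarrow> real" where
  "block_sum p x = sum (Poly_Mapping.lookup (Poly_Mapping.lookup x (fst p))) (snd p)"

lemma linear_block_sum: "linear (block_sum p)"
  by (rule linearI) (simp_all add: block_sum_def lookup_add sum.distrib sum_distrib_left)

lemma subspace_product_space: "subspace (product_space cs)"
  unfolding subspace_def product_space_def by (simp add: lookup_add)

text \<open>The index \<open>(j, S)\<close> is Rado's inequality for \<open>S\<close> in factor
  \<open>j\<close>, an equation for the full set. The trivial inequality for \<open>S = {}\<close>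
  is included because it is always tight, as \<open>{}\<close> belongs to every flag.\<close>

interpretation product: polyhedron_in_subspace "product_space cs"
  "SIGMA j:{..<length cs}. Pow {1..cs ! j}" "(\<lambda>j. (j, {1..cs ! j})) ` {..<length cs}"
  block_sum "\<lambda>p. triangular (card (snd p))" for cs
  by (rule polyhedron_in_subspace.intro) (auto simp: subspace_product_space linear_block_sum)

lemma permutohedron_product_eq: "permutohedron_product cs = product.polyhedron_set cs"
proof (rule set_eqI)
  fix x
  have "x \<in> product.polyhedron_set cs \<longleftrightarrow> x \<in> product_space cs \<and>
      (\<forall>j<length cs. permutohedral {1..cs ! j} (Poly_Mapping.lookup (Poly_Mapping.lookup x j)))"
    unfolding product.polyhedron_set_def permutohedral_def block_sum_def by auto
  then show "x \<in> permutohedron_product cs \<longleftrightarrow> x \<in> product.polyhedron_set cs"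
    unfolding permutohedron_product_def permutohedron_eq_halfspaces permutohedron_halfspaces_def
      product_space_def by auto
qed

lemma product_tight_eq:
  "product.tight cs x =
    (SIGMA j:{..<length cs}. tight_sets {1..cs ! j} (Poly_Mapping.lookup (Poly_Mapping.lookup x j)))"
  unfolding product.tight_def tight_sets_def block_sum_def by auto

lemma lookup_poly_mapping_of_finite:
  assumes "finite A"
  shows "\<exists>v. \<forall>i. Poly_Mapping.lookup v i = (if i \<in> A then f i else 0)"
proof -
  have "finite {i. (if i \<in> A then f i else 0) \<noteq> 0}"
    by (rule finite_subset[OF _ assms]) auto
  then show ?thesis
    by (intro exI[of _ "Abs_poly_mapping (\<lambda>i. if i \<in> A then f i else 0)"])
      (simp add: Abs_poly_mapping_inverse)
qed

text \<open>Each inequality involves a single factor, so flags can be realized in the factors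
  independently.\<close>

lemma product_tight_image:
  "product.tight cs ` product.polyhedron_set cs =
    (\<lambda>g. SIGMA j:{..<length cs}. g j) ` (\<Pi>\<^sub>E j\<in>{..<length cs}. flags {1..cs ! j})"
proof (intro equalityI subsetI)
  fix T assume "T \<in> product.tight cs ` product.polyhedron_set cs"
  then obtain x where x: "x \<in> permutohedron_product cs" "T = product.tight cs x"
    by (auto simp: permutohedron_product_eq)
  define g where "g = (\<lambda>j\<in>{..<length cs}.
    tight_sets {1..cs ! j} (Poly_Mapping.lookup (Poly_Mapping.lookup x j)))"
  have "permutohedral {1..cs ! j} (Poly_Mapping.lookup (Poly_Mapping.lookup x j))"
    if "j < length cs" for j
    using x(1) that by (simp add: permutohedron_product_def permutohedron_eq_halfspaces
        permutohedron_halfspaces_def)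
  then have "g \<in> (\<Pi>\<^sub>E j\<in>{..<length cs}. flags {1..cs ! j})"
    using tight_sets_in_flags unfolding g_def by (intro restrict_PiE_iff[THEN iffD2]) auto
  moreover have "T = (SIGMA j:{..<length cs}. g j)"
    unfolding x(2) product_tight_eq g_def by auto
  ultimately show "T \<in> (\<lambda>g. SIGMA j:{..<length cs}. g j) ` (\<Pi>\<^sub>E j\<in>{..<length cs}. flags {1..cs ! j})"
    by blast
next
  fix T assume "T \<in> (\<lambda>g. SIGMA j:{..<length cs}. g j) ` (\<Pi>\<^sub>E j\<in>{..<length cs}. flags {1..cs ! j})"
  then obtain g where g: "T = (SIGMA j:{..<length cs}. g j)"
    "\<And>j. j < length cs \<Longrightarrow> g j \<in> flags {1..cs ! j}" by (auto simp: PiE_iff)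
  have "\<exists>v. v \<in> permutohedron (cs ! j) \<and> tight_sets {1..cs ! j} (Poly_Mapping.lookup v) = g j"
    if j: "j < length cs" for j
  proof -
    obtain y where y: "permutohedral {1..cs ! j} y" "tight_sets {1..cs ! j} y = g j"
      using flag_realized[OF _ g(2)[OF j]] by auto
    obtain v where v: "\<And>i. Poly_Mapping.lookup v i = (if i \<in> {1..cs ! j} then y i else 0)"
      using lookup_poly_mapping_of_finite[of "{1..cs ! j}" y] by auto
    have "sum (Poly_Mapping.lookup v) S = sum y S" if "S \<subseteq> {1..cs ! j}" for S
      using that by (intro sum.cong) (auto simp: v)
    then have "permutohedral {1..cs ! j} (Poly_Mapping.lookup v)"
      "tight_sets {1..cs ! j} (Poly_Mapping.lookup v) = tight_sets {1..cs ! j} y"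
      using y(1) by (auto simp: permutohedral_def tight_sets_def)
    then have "v \<in> permutohedron (cs ! j) \<and> tight_sets {1..cs ! j} (Poly_Mapping.lookup v) = g j"
      using y(2) v by (simp add: permutohedron_eq_halfspaces permutohedron_halfspaces_def)
    then show ?thesis by blast
  qed
  then obtain w where w: "\<And>j. j < length cs \<Longrightarrow> w j \<in> permutohedron (cs ! j)"
    "\<And>j. j < length cs \<Longrightarrow> tight_sets {1..cs ! j} (Poly_Mapping.lookup (w j)) = g j"
    by metis
  obtain x where x: "\<And>j. Poly_Mapping.lookup x j = (if j \<in> {..<length cs} then w j else 0)"
    using lookup_poly_mapping_of_finite[of "{..<length cs}" w] by auto
  have "x \<in> product.polyhedron_set cs"
    unfolding permutohedron_product_eq[symmetric] permutohedron_product_def using w(1) x by simp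
  moreover have "T = product.tight cs x"
    unfolding product_tight_eq g(1) using w(2) x by (intro Sigma_cong) auto
  ultimately show "T \<in> product.tight cs ` product.polyhedron_set cs" by blast
qed

lemma bij_betw_product_faces:
  "bij_betw (\<lambda>g. product.tight_face cs (SIGMA j:{..<length cs}. g j))
     (\<Pi>\<^sub>E j\<in>{..<length cs}. flags {1..cs ! j}) {F. F face_of permutohedron_product cs \<and> F \<noteq> {}}"
proof -
  have "inj_on (\<lambda>g. SIGMA j:{..<length cs}. g j) (\<Pi>\<^sub>E j\<in>{..<length cs}. flags {1..cs ! j})"
  proof (rule inj_onI)
    fix g h
    assume gh: "g \<in> (\<Pi>\<^sub>E j\<in>{..<length cs}. flags {1..cs ! j})"
      "h \<in> (\<Pi>\<^sub>E j\<in>{..<length cs}. flags {1..cs ! j})"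
      and eq: "(SIGMA j:{..<length cs}. g j) = (SIGMA j:{..<length cs}. h j)"
    show "g = h"
    proof (rule PiE_ext[OF gh])
      fix j assume "j \<in> {..<length cs}"
      then have "g j = (SIGMA j:{..<length cs}. g j) `` {j}" "h j = (SIGMA j:{..<length cs}. h j) `` {j}"
        by auto
      then show "g j = h j" using eq by simp
    qed
  qed
  then have "bij_betw (\<lambda>g. SIGMA j:{..<length cs}. g j) (\<Pi>\<^sub>E j\<in>{..<length cs}. flags {1..cs ! j})
      (product.tight cs ` product.polyhedron_set cs)"
    unfolding product_tight_image by (rule inj_on_imp_bij_betw)
  from bij_betw_trans[OF this product.bij_betw_tight_face] show ?thesis
    by (simp add: permutohedron_product_eq o_def)
qed

section \<open>Dimensions of the faces of a product\<close>

definition unit_vectors :: "nat list \<Rightarrow> (nat \<Rightarrow>\<^sub>0 nat \<Rightarrow>\<^sub>0 real) set" where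
  "unit_vectors cs = (\<lambda>(j, i). Poly_Mapping.single j (Poly_Mapping.single i 1)) `
     (SIGMA j:{..<length cs}. {1..cs ! j})"

lemma unit_vector_in_product_space:
  "j < length cs \<Longrightarrow> i \<in> {1..cs ! j} \<Longrightarrow>
    Poly_Mapping.single j (Poly_Mapping.single i 1) \<in> product_space cs"
  by (auto simp: product_space_def lookup_single when_def)

lemma block_sum_unit_vector:
  assumes "finite S"
  shows "block_sum (k, S) (Poly_Mapping.single j (Poly_Mapping.single i 1)) = of_bool (j = k \<and> i \<in> S)"
  using assms by (cases "j = k") (simp_all add: block_sum_def lookup_single when_def)

lemma product_space_subset_span: "product_space cs \<subseteq> span (unit_vectors cs)"
proof
  fix x assume x: "x \<in> product_space cs"
  let ?y = "\<Sum>j<length cs. \<Sum>i\<in>{1..cs ! j}.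
    Poly_Mapping.lookup (Poly_Mapping.lookup x j) i *\<^sub>R Poly_Mapping.single j (Poly_Mapping.single i (1::real))"
  have "x = ?y"
  proof (intro poly_mapping_eqI)
    fix j i
    have inner: "(\<Sum>h\<in>{1..cs ! k}. if k = j \<and> h = i then f h else 0) =
        (if k = j then if i \<in> {1..cs ! k} then f i else 0 else 0)" for k and f :: "nat \<Rightarrow> real"
      by (cases "k = j") simp_all
    have "Poly_Mapping.lookup (Poly_Mapping.lookup ?y j) i =
      (\<Sum>k<length cs. \<Sum>h\<in>{1..cs ! k}.
        if k = j \<and> h = i then Poly_Mapping.lookup (Poly_Mapping.lookup x k) h else 0)"
      by (auto simp: lookup_sum lookup_single when_def intro!: sum.cong)
    also have "\<dots> = Poly_Mapping.lookup (Poly_Mapping.lookup x j) i"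
      unfolding inner using x by (auto simp: product_space_def not_less)
    finally show "Poly_Mapping.lookup (Poly_Mapping.lookup x j) i =
      Poly_Mapping.lookup (Poly_Mapping.lookup ?y j) i" by simp
  qed
  moreover have "?y \<in> span (unit_vectors cs)"
    by (intro span_sum span_scale span_base) (auto simp: unit_vectors_def)
  ultimately show "x \<in> span (unit_vectors cs)" by simp
qed

lemma finite_unit_vectors: "finite (unit_vectors cs)"
  by (simp add: unit_vectors_def)

lemma dim_product_space: "dim (product_space cs) = (\<Sum>j<length cs. cs ! j)"
proof -
  let ?S = "SIGMA j:{..<length cs}. (\<lambda>i. {i}) ` {1..cs ! j}"
  have "dim {x \<in> product_space cs. \<forall>p\<in>?S. block_sum p x = 0} + card ?S = dim (product_space cs)"
  \<comment> \<open>The unit vectors are dual to the coordinate functionals, so the order is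
    irrelevant and the rank can be constant.\<close>
  proof (rule dim_common_kernel[OF subspace_product_space product_space_subset_span
        finite_unit_vectors, where rk = "\<lambda>_. 0"])
    fix p assume "p \<in> ?S"
    then obtain j i where p: "p = (j, {i})" "j < length cs" "i \<in> {1..cs ! j}" by auto
    show "\<exists>v\<in>product_space cs. block_sum p v \<noteq> 0 \<and> (\<forall>q\<in>?S. 0 \<le> (0::nat) \<longrightarrow> q \<noteq> p \<longrightarrow> block_sum q v = 0)"
      using p by (intro bexI[OF _ unit_vector_in_product_space[OF p(2,3)]])
        (auto simp: block_sum_unit_vector)
  qed (auto simp: linear_block_sum)
  moreover have "{x \<in> product_space cs. \<forall>p\<in>?S. block_sum p x = 0} = {0}"
  proof (intro equalityI subsetI)
    fix x assume x: "x \<in> {x \<in> product_space cs. \<forall>p\<in>?S. block_sum p x = 0}"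
    have "Poly_Mapping.lookup (Poly_Mapping.lookup x j) i = 0" for j i
    proof (cases "j < length cs \<and> i \<in> {1..cs ! j}")
      case True
      then have "(j, {i}) \<in> ?S" by auto
      with x have "block_sum (j, {i}) x = 0" by blast
      then show ?thesis by (simp add: block_sum_def)
    next
      case False
      with x show ?thesis by (cases "j < length cs") (auto simp: product_space_def not_less)
    qed
    then show "x \<in> {0}" by (auto intro!: poly_mapping_eqI)
  qed (auto simp: product_space_def block_sum_def)
  moreover have "card ?S = (\<Sum>j<length cs. cs ! j)"
    by (simp add: card_SigmaI card_image)
  moreover have "dim {0 :: nat \<Rightarrow>\<^sub>0 nat \<Rightarrow>\<^sub>0 real} = 0"
    by (rule real_vector.dim_unique[of "{}"]) (auto simp: real_vector.independent_empty)
  ultimately show ?thesis by simp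
qed

text \<open>The functional of \<open>{}\<close> is zero and is discarded, hence
  \<open>card (g j) - 1\<close>. The others are ranked by cardinality: the witness for
  \<open>S\<close> is the unit vector of an element that first appears in \<open>S\<close>, on which
  all other members of the flag that are no larger than \<open>S\<close> vanish.\<close>

lemma dim_flag_kernel:
  assumes g: "\<And>j. j < length cs \<Longrightarrow> g j \<in> flags {1..cs ! j}"
  shows "dim {x \<in> product_space cs. \<forall>p\<in>(SIGMA j:{..<length cs}. g j). block_sum p x = 0} +
    (\<Sum>j<length cs. card (g j) - 1) = (\<Sum>j<length cs. cs ! j)"
proof -
  let ?S = "SIGMA j:{..<length cs}. g j - {{}}"
  have fin: "finite (g j)" if "j < length cs" for j
    using g[OF that] by (rule flags_finite[rotated]) simp
  have finS: "finite S" if "j < length cs" "S \<in> g j" for j S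
  proof -
    have "S \<subseteq> {1..cs ! j}" using g[OF that(1)] that(2) by (auto simp: flags_def)
    then show ?thesis by (rule finite_subset) simp
  qed
  have "dim {x \<in> product_space cs. \<forall>p\<in>?S. block_sum p x = 0} + card ?S = dim (product_space cs)"
  proof (rule dim_common_kernel[OF subspace_product_space product_space_subset_span
        finite_unit_vectors, where rk = "\<lambda>p. card (snd p)"])
    show "finite ?S" using fin by (intro finite_SigmaI) auto
    fix p assume "p \<in> ?S"
    then obtain j S where p: "p = (j, S)" "j < length cs" "S \<in> g j" "S \<noteq> {}" by auto
    let ?P = "{S' \<in> g j. S' \<subset> S}"
    have chain: "chain_subset (g j)" "{} \<in> g j" "S \<subseteq> {1..cs ! j}"
      using g[OF p(2)] p(3) by (auto simp: flags_def)
    \<comment> \<open>The proper predecessors of \<open>S\<close> have a largest one, which is still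
      a proper subset of \<open>S\<close>.\<close>
    have "\<Union>?P \<in> ?P"
      using fin[OF p(2)] chain p(4)
      by (intro Union_finite_chain_in) (auto simp: chain_subset_def)
    then obtain a where a: "a \<in> S" "a \<notin> \<Union>?P" by blast
    let ?v = "Poly_Mapping.single j (Poly_Mapping.single a (1::real))"
    have zero: "block_sum q ?v = 0" if q: "q \<in> ?S" "card (snd q) \<le> card (snd p)" "q \<noteq> p" for q
    proof -
      obtain k S' where k: "q = (k, S')" "k < length cs" "S' \<in> g k" using q(1) by auto
      have "\<not> (j = k \<and> a \<in> S')"
      proof
        assume *: "j = k \<and> a \<in> S'"
        then have "S' \<noteq> S" "S' \<in> g j" using q(3) p k by auto
        moreover have "\<not> S \<subset> S'"
          using psubset_card_mono[OF finS[OF k(2,3)], of S] q(2) p(1) k(1) by auto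
        ultimately have "S' \<in> ?P"
          using chain(1) p(3) by (auto simp: chain_subset_def)
        then show False using * a by blast
      qed
      then show ?thesis
        using finS[OF k(2,3)] k(1) by (simp add: block_sum_unit_vector)
    qed
    have nonzero: "block_sum p ?v \<noteq> 0"
      using finS[OF p(2,3)] a p(1) by (simp add: block_sum_unit_vector)
    have mem: "?v \<in> product_space cs"
      by (rule unit_vector_in_product_space[OF p(2) subsetD[OF chain(3) a(1)]])
    show "\<exists>v\<in>product_space cs. block_sum p v \<noteq> 0 \<and>
        (\<forall>q\<in>?S. card (snd q) \<le> card (snd p) \<longrightarrow> q \<noteq> p \<longrightarrow> block_sum q v = 0)"
    proof (intro bexI[of _ ?v] conjI ballI impI)
      show "block_sum q ?v = 0" if "q \<in> ?S" "card (snd q) \<le> card (snd p)" "q \<noteq> p" for q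
        using that by (rule zero)
    qed (fact nonzero mem)+
  qed (auto simp: linear_block_sum)
  moreover have "(\<forall>p\<in>?S. block_sum p x = 0) \<longleftrightarrow> (\<forall>p\<in>(SIGMA j:{..<length cs}. g j). block_sum p x = 0)" for x
  proof (intro iffI ballI)
    fix p assume S: "\<forall>p\<in>?S. block_sum p x = 0" and p: "p \<in> (SIGMA j:{..<length cs}. g j)"
    show "block_sum p x = 0"
    proof (cases "snd p = {}")
      case False
      then have "p \<in> ?S" using p by auto
      then show ?thesis using S by blast
    qed (simp add: block_sum_def)
  qed auto
  moreover have "card ?S = (\<Sum>j<length cs. card (g j) - 1)"
    using fin g by (subst card_SigmaI) (auto simp: flags_def card_Diff_singleton)
  ultimately show ?thesis by (simp add: dim_product_space)
qed

lemma affine_dimension_product_face: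
  assumes g: "g \<in> (\<Pi>\<^sub>E j\<in>{..<length cs}. flags {1..cs ! j})"
  shows "affine_dimension (product.tight_face cs (SIGMA j:{..<length cs}. g j)) +
    (\<Sum>j<length cs. card (g j) - 1) = (\<Sum>j<length cs. cs ! j)"
proof -
  obtain x where x: "x \<in> product.polyhedron_set cs" "(SIGMA j:{..<length cs}. g j) = product.tight cs x"
    using g product_tight_image[of cs] by (metis (no_types, lifting) imageE imageI)
  show ?thesis
    using product.affine_dimension_tight_face[OF x(1)] dim_flag_kernel[of cs g] g
    unfolding x(2) by (auto simp: PiE_iff)
qed

lemma finite_product_faces: "finite {F. F face_of permutohedron_product cs \<and> F \<noteq> {}}"
proof -
  have "finite (\<Pi>\<^sub>E j\<in>{..<length cs}. flags {1..cs ! j})"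
    by (intro finite_PiE finite_flags) auto
  then show ?thesis
    by (rule iffD1[OF bij_betw_finite[OF bij_betw_product_faces[of cs]]])
qed

text \<open>The first flag contains both \<open>{}\<close> and a nonempty full set, so at least one
  dimension is lost. This guarantees that the range \<open>0..n - 1\<close> of dimensions misses no
  face.\<close>

lemma affine_dimension_less:
  assumes F: "F face_of permutohedron_product cs" "F \<noteq> {}" and cs: "cs \<noteq> []" "0 \<notin> set cs"
  shows "affine_dimension F < sum_list cs"
proof -
  have "F \<in> (\<lambda>g. product.tight_face cs (SIGMA j:{..<length cs}. g j)) `
      (\<Pi>\<^sub>E j\<in>{..<length cs}. flags {1..cs ! j})"
    unfolding bij_betw_imp_surj_on[OF bij_betw_product_faces[of cs]] using F by simp
  then obtain g where g: "g \<in> (\<Pi>\<^sub>E j\<in>{..<length cs}. flags {1..cs ! j})"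
    "F = product.tight_face cs (SIGMA j:{..<length cs}. g j)"
    by (rule imageE)
  have g0: "g 0 \<in> flags {1..cs ! 0}" using g(1) cs(1) by (auto simp: PiE_iff)
  then have "{{}, {1..cs ! 0}} \<subseteq> g 0" by (auto simp: flags_def)
  moreover have "finite (g 0)" using flags_finite[OF _ g0] by simp
  moreover have "cs ! 0 \<noteq> 0" using cs by (metis length_greater_0_conv nth_mem)
  ultimately have "2 \<le> card (g 0)"
    using card_mono[of "g 0" "{{}, {1..cs ! 0}}"] by simp
  then have "0 < (\<Sum>j<length cs. card (g j) - 1)"
    using cs(1) by (intro sum_pos2[of _ 0]) auto
  then show ?thesis
    using affine_dimension_product_face[OF g(1)] g(2)
    by (simp add: sum_list_sum_nth atLeast0LessThan)
qed

text \<open>Both exponents are sums over the factors, so the weight of a face is a product of flag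
  weights, and the sum over tuples of flags factors.\<close>

lemma sum_product_faces:
  fixes t :: "'b::comm_ring_1"
  shows "(\<Sum>F | F face_of permutohedron_product cs \<and> F \<noteq> {}.
      t ^ (sum_list cs - affine_dimension F) * (1 - t) ^ affine_dimension F) =
    (\<Prod>j<length cs. \<Sum>T\<in>flags {1..cs ! j}. flag_weight t {1..cs ! j} T)"
proof -
  let ?G = "\<Pi>\<^sub>E j\<in>{..<length cs}. flags {1..cs ! j}"
  let ?F = "\<lambda>g. product.tight_face cs (SIGMA j:{..<length cs}. g j)"
  have "(\<Sum>F | F face_of permutohedron_product cs \<and> F \<noteq> {}.
      t ^ (sum_list cs - affine_dimension F) * (1 - t) ^ affine_dimension F) =
    (\<Sum>g\<in>?G. t ^ (sum_list cs - affine_dimension (?F g)) * (1 - t) ^ affine_dimension (?F g))"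
    by (rule sum.reindex_bij_betw[OF bij_betw_product_faces, symmetric])
  also have "\<dots> = (\<Sum>g\<in>?G. \<Prod>j<length cs. flag_weight t {1..cs ! j} (g j))"
  proof (rule sum.cong)
    fix g assume g: "g \<in> ?G"
    have card_g: "1 \<le> card (g j)" "card (g j) \<le> Suc (cs ! j)" if "j < length cs" for j
      using card_flag[of "{1..cs ! j}" "g j"] g that by (auto simp: PiE_iff)
    have "(\<Sum>j<length cs. cs ! j + 1 - card (g j)) + (\<Sum>j<length cs. card (g j) - 1) = (\<Sum>j<length cs. cs ! j)"
      unfolding sum.distrib[symmetric] using card_g by (intro sum.cong) (auto simp: Suc_le_eq)
    then have "affine_dimension (?F g) = (\<Sum>j<length cs. cs ! j + 1 - card (g j))"
      "sum_list cs - affine_dimension (?F g) = (\<Sum>j<length cs. card (g j) - 1)"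
      using affine_dimension_product_face[OF g] by (simp_all add: sum_list_sum_nth atLeast0LessThan)
    then show "t ^ (sum_list cs - affine_dimension (?F g)) * (1 - t) ^ affine_dimension (?F g) =
        (\<Prod>j<length cs. flag_weight t {1..cs ! j} (g j))"
      by (simp add: flag_weight_def prod.distrib power_sum)
  qed simp
  also have "\<dots> = (\<Prod>j<length cs. \<Sum>T\<in>flags {1..cs ! j}. flag_weight t {1..cs ! j} T)"
    by (rule prod_sum_PiE[symmetric]) (auto simp: finite_flags)
  finally show ?thesis .
qed

section \<open>The Eulerian polynomial\<close>

lemma prod_list_conv_prod: "prod_list (map f xs) = (\<Prod>j<length xs. f (xs ! j))"
  by (induction xs) (simp_all add: prod.lessThan_Suc_shift del: prod.lessThan_Suc)

lemma sum_list_partition_type: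
  assumes "\<tau> \<in> colored_ordered_set_partitions n C \<beta>"
  shows "sum_list (partition_type \<tau>) = n"
proof -
  have "sum_list (map (\<lambda>p. card (fst p)) \<tau>) = card (\<Union>(fst ` set \<tau>))"
    if "sorted_wrt (\<lambda>p q. fst p \<inter> fst q = {}) \<tau>" "finite (\<Union>(fst ` set \<tau>))"
    for \<tau> :: "(nat set \<times> 'a) list"
    using that
  proof (induction \<tau>)
    case (Cons p \<tau>)
    have "fst p \<inter> \<Union>(fst ` set \<tau>) = {}" using Cons.prems by auto
    then show ?case using Cons by (simp add: card_Un_disjoint)
  qed simp
  from this[of \<tau>] show ?thesis
    using assms by (simp add: colored_ordered_set_partitions_iff partition_type_def case_prod_unfold
        del: finite_UN finite_Union)
qed

text \<open>The comparison of flags with permutations is carried out block by block, after replacing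
  each \<open>{1..c}\<close> by the block of size \<open>c\<close> itself.\<close>

lemma sum_product_faces_partition:
  fixes t :: "'b::comm_ring_1"
  assumes \<tau>: "\<tau> \<in> colored_ordered_set_partitions n C \<beta>"
  shows "(\<Sum>F | F face_of permutohedron_product (partition_type \<tau>) \<and> F \<noteq> {}.
      t ^ (n - affine_dimension F) * (1 - t) ^ affine_dimension F) =
    (\<Prod>p\<leftarrow>\<tau>. \<Sum>u\<in>permutations_of_set (fst p). descent_weight t u)"
proof -
  have "(\<Prod>j<length \<tau>. \<Sum>T\<in>flags {1..partition_type \<tau> ! j}. flag_weight t {1..partition_type \<tau> ! j} T) =
      (\<Prod>j<length \<tau>. \<Sum>u\<in>permutations_of_set (fst (\<tau> ! j)). descent_weight t u)"
  proof (rule prod.cong)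
    fix j assume "j \<in> {..<length \<tau>}"
    then have j: "j < length \<tau>" by simp
    then have "fst (\<tau> ! j) \<subseteq> {1..n}"
      using \<tau> nth_mem[OF j] unfolding colored_ordered_set_partitions_iff by (metis UN_upper)
    then have "finite (fst (\<tau> ! j))" by (rule finite_subset) simp
    moreover have "partition_type \<tau> ! j = card (fst (\<tau> ! j))"
      using j by (simp add: partition_type_def case_prod_unfold)
    ultimately show "(\<Sum>T\<in>flags {1..partition_type \<tau> ! j}. flag_weight t {1..partition_type \<tau> ! j} T) =
        (\<Sum>u\<in>permutations_of_set (fst (\<tau> ! j)). descent_weight t u)"
      using sum_flag_weight_card_cong[of "{1..partition_type \<tau> ! j}" "fst (\<tau> ! j)" t]
      by (simp add: sum_flag_weight_eq_descent_weight)
  qed simp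
  moreover have "length (partition_type \<tau>) = length \<tau>" by (simp add: partition_type_def)
  ultimately show ?thesis
    using sum_product_faces[of t "partition_type \<tau>"]
    unfolding sum_list_partition_type[OF \<tau>] prod_list_conv_prod by simp
qed

theorem theorem6p4:
  fixes n \<alpha> :: nat and C :: "'c set" and \<beta> :: 'c
  assumes "n \<ge> 1" and "\<alpha> \<ge> 1"
    and "finite C" and "card C = \<alpha>" and "\<beta> \<in> C"
  shows "colored_eulerian_polynomial n C \<beta> =
           (\<Sum>w\<in>colored_permutations n C \<beta>. monom 1 (colored_descents w))"
proof -
  define t :: "real poly" where "t = monom 1 1"
  have t_eq: "t = [:0, 1:]"
    unfolding t_def by (simp add: monom_Suc monom_0)
  have one_minus_t: "[:1, -1:] = 1 - t"
    by (subst one_pCons) (simp add: t_eq)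
  have power_t: "monom 1 k = t ^ k" for k
    by (simp add: t_def monom_power)
  have t_nz: "t \<noteq> 0" by (simp add: t_def)
  let ?P = "{\<tau>. \<tau> \<in> colored_ordered_set_partitions n C \<beta> \<and> alternating \<tau>}"
  let ?F = "\<lambda>\<tau>. {F. F face_of permutohedron_product (partition_type \<tau>) \<and> F \<noteq> {}}"
  let ?faces = "colored_permutohedron_faces n C \<beta>"
  have faces_eq: "?faces = Sigma ?P ?F"
    by (auto simp: colored_permutohedron_faces_def)
  have finP: "finite ?P"
    using finite_colored_ordered_set_partitions[OF assms(3)] by simp
  have fin: "finite ?faces"
    unfolding faces_eq using finP finite_product_faces by (intro finite_SigmaI) auto
  \<comment> \<open>Needed twice: to regroup the sum over dimensions as a sum over all faces, and to
    keep the subtraction in \<open>n - 1 - d\<close> exact.\<close>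
  have dim_less: "affine_dimension (snd q) < n" if "q \<in> ?faces" for q
  proof -
    obtain \<tau> F where q: "q = (\<tau>, F)" "\<tau> \<in> colored_ordered_set_partitions n C \<beta>"
      "F face_of permutohedron_product (partition_type \<tau>)" "F \<noteq> {}"
      using \<open>q \<in> ?faces\<close> by (cases q) (auto simp: colored_permutohedron_faces_def)
    have ne: "\<tau> \<noteq> []" "\<forall>p\<in>set \<tau>. fst p \<noteq> {}" "\<Union>(fst ` set \<tau>) = {1..n}"
      using q(2) by (auto simp: colored_ordered_set_partitions_iff)
    have "card (fst p) \<noteq> 0" if p: "p \<in> set \<tau>" for p
    proof -
      have "fst p \<subseteq> {1..n}" using ne(3) p by (metis UN_upper)
      then have "finite (fst p)" by (rule finite_subset) simp
      then show ?thesis using ne(2) p by simp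
    qed
    then have "partition_type \<tau> \<noteq> []" "0 \<notin> set (partition_type \<tau>)"
      using ne(1) by (force simp: partition_type_def case_prod_unfold)+
    from affine_dimension_less[OF q(3,4) this] show ?thesis
      using sum_list_partition_type[OF q(2)] q(1) by simp
  qed
  have "colored_eulerian_polynomial n C \<beta> =
      (\<Sum>d = 0..n - 1. \<Sum>q | q \<in> ?faces \<and> affine_dimension (snd q) = d. t ^ (n - 1 - d) * (1 - t) ^ d)"
    unfolding colored_eulerian_polynomial_def face_number_def one_minus_t power_t
    by (simp add: case_prod_unfold of_nat_poly)
  also have "\<dots> = (\<Sum>d = 0..n - 1. \<Sum>q | q \<in> ?faces \<and> affine_dimension (snd q) = d.
      t ^ (n - 1 - affine_dimension (snd q)) * (1 - t) ^ affine_dimension (snd q))"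
    by (intro sum.cong) auto
  also have "\<dots> = (\<Sum>q\<in>?faces. t ^ (n - 1 - affine_dimension (snd q)) * (1 - t) ^ affine_dimension (snd q))"
    by (rule sum.group) (use fin dim_less in force)+
  \<comment> \<open>The factor raises the exponent to \<open>n - d\<close>, which is additive over
    blocks; it cancels at the end since \<open>t\<close> is a nonzero polynomial.\<close>
  finally have "t * colored_eulerian_polynomial n C \<beta> =
      (\<Sum>q\<in>?faces. t * (t ^ (n - 1 - affine_dimension (snd q)) * (1 - t) ^ affine_dimension (snd q)))"
    by (simp add: sum_distrib_left)
  also have "\<dots> = (\<Sum>q\<in>?faces. t ^ (n - affine_dimension (snd q)) * (1 - t) ^ affine_dimension (snd q))"
  proof (rule sum.cong)
    fix q assume "q \<in> ?faces"
    then have "n - affine_dimension (snd q) = Suc (n - 1 - affine_dimension (snd q))"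
      using dim_less[of q] by simp
    then show "t * (t ^ (n - 1 - affine_dimension (snd q)) * (1 - t) ^ affine_dimension (snd q)) =
        t ^ (n - affine_dimension (snd q)) * (1 - t) ^ affine_dimension (snd q)"
      by (simp add: mult.assoc)
  qed simp
  also have "\<dots> = (\<Sum>\<tau>\<in>?P. \<Sum>F\<in>?F \<tau>. t ^ (n - affine_dimension F) * (1 - t) ^ affine_dimension F)"
    unfolding faces_eq using finP finite_product_faces
    by (subst sum.Sigma) (auto simp: case_prod_unfold)
  also have "\<dots> = (\<Sum>\<tau>\<in>?P. \<Prod>p\<leftarrow>\<tau>. \<Sum>u\<in>permutations_of_set (fst p). descent_weight t u)"
    using sum_product_faces_partition by (intro sum.cong) auto
  also have "\<dots> = (\<Sum>w\<in>colored_permutations n C \<beta>. colored_weight t w)"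
    by (rule sum_colored_weight[OF assms(3), symmetric])
  also have "\<dots> = (\<Sum>w\<in>colored_permutations n C \<beta>. t * monom 1 (colored_descents w))"
    unfolding power_t by (intro sum.cong) (auto simp: colored_weight_eq_power colored_permutations_def)
  also have "\<dots> = t * (\<Sum>w\<in>colored_permutations n C \<beta>. monom 1 (colored_descents w))"
    by (simp add: sum_distrib_left)
  finally show ?thesis using t_nz by simp
qed

end
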